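(* Consider $\min_{x\in\mathbb{R}^n}\Phi(x)$, $\Phi=\Psi+\mathcal{X}$, $\Psi=f+h$, where $f$ is differentiable with $L_f$-Lipschitz gradient (possibly nonconvex), $h$ is convex and differentiable with $L_h$-Lipschitz gradient, $L_\Psi=L_f+L_h$, and $\mathcal{X}$ is a proper closed convex function with bounded domain. Let $\mathcal{P}(x,y,c):=\operatorname{argmin}_u\{\langle y,u\rangle+\frac1{2c}\|u-x\|^2+\mathcal{X}(u)\}$, $\mathcal{G}(x,y,c):=\frac1c[x-\mathcal{P}(x,y,c)]$, and assume there is $M$ with $\|\mathcal{P}(x,y,c)\|\le M$ for all $c>0$, $x,y$. A stochastic oracle returns, at each call with input $x$, $G(x,\xi)$ where, for every call, $\mathbb{E}[G(x,\xi)]=\nabla\Psi(x)$ and $\mathbb{E}[\|G(x,\xi)-\nabla\Psi(x)\|^2]\le\sigma^2$. Consider the mini-batch RSAG method: given $x_0$, $\{\alpha_k\}$ with $\alpha_1=1$, $\alpha_k\in(0,1)$ ($k\ge2$), $\{\beta_k>0\}$, $\{\lambda_k>0\}$, batch sizes $m_k\ge1$, $N\ge1$ and probabilities $p_1,\ldots,p_N$, draw $R$ with $\mathrm{Prob}\{R=k\}=p_k$, set $x^{ag}_0=x_0$, and for $k=1,\ldots,R$: $$x^{md}_k=(1-\alpha_k)x^{ag}_{k-1}+\alpha_kx_{k-1},\quad\bar G_k=\frac1{m_k}\sum_{i=1}^{m_k}G(x^{md}_k,\xi_{k,i}),\quad x_k=\mathcal{P}(x_{k-1},\bar G_k,\lambda_k),\quad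 x^{ag}_k=\mathcal{P}(x^{md}_k,\bar G_k,\beta_k),$$ where $G(x^{md}_k,\xi_{k,i})$ is the output of the $i$-th oracle call at iteration $k$. Let $\Gamma_1=1$, $\Gamma_k=(1-\alpha_k)\Gamma_{k-1}$. Suppose $\alpha_k\lambda_k\le\beta_k<1/L_\Psi$, $\frac{\alpha_1}{\lambda_1\Gamma_1}\ge\frac{\alpha_2}{\lambda_2\Gamma_2}\ge\cdots$, $p_k=\frac{\Gamma_k^{-1}\beta_k(1-L_\Psi\beta_k)}{\sum_{j=1}^N\Gamma_j^{-1}\beta_j(1-L_\Psi\beta_j)}$, and let $x^*$ be an optimal solution of $\min\Phi$ (assumed to exist). Then $$\mathbb{E}[\|\mathcal{G}(x^{md}_R,\nabla\Psi(x^{md}_R),\beta_R)\|^2]\le8\Big[\sum_{k=1}^N\Gamma_k^{-1}\beta_k(1-L_\Psi\beta_k)\Big]^{-1}\Big[\frac{\|x_0-x^*\|^2}{2\lambda_1}+\frac{L_f}{\Gamma_N}(\|x^*\|^2+2M^2)+\sigma^2\sum_{k=1}^N\frac{\beta_k(4+(1-L_\Psi\beta_k)^2)}{4\Gamma_k(1-L_\Psi\beta_k)m_k}\Big],$$ the expectation taken over $R$ and all $\xi_{k,i}$. If in addition $L_f=0$, then $$\mathbb{E}[\Phi(x^{ag}_R)-\Phi(x^* )]\le\Big[\sum_{k=1}^N\Gamma_k^{-1}\beta_k(1-L_\Psi\beta_k)\Big]^{-1}\Big[\sum_{k=1}^N\beta_k(1-L_\Psi\beta_k)\Big(\frac{\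|x_0-x^*\|^2}{2\lambda_1}+\sigma^2\sum_{j=1}^k\frac{\beta_j(4+(1-L_\Psi\beta_j)^2)}{4\Gamma_j(1-L_\Psi\beta_j)m_j}\Big)\Big].$$
   Context: $\|\cdot\|$ is the Euclidean norm. $R$ is drawn independently of the oracle randomness. *)

theory Defs
  imports "HOL-Probability.Probability"
begin

definition epigraph :: "('a \<Rightarrow> ereal) \<Rightarrow> ('a \<times> real) set" where
  "epigraph X = {(x, t). X x \<le> ereal t}"

definition effective_domain :: "('a \<Rightarrow> ereal) \<Rightarrow> 'a set" where
  "effective_domain X = {x. X x < \<infinity>}"

definition proper_function :: "('a \<Rightarrow> ereal) \<Rightarrow> bool" where
  "proper_function X \<longleftrightarrow> (\<forall>x. X x \<noteq> -\<infinity>) \<and> (\<exists>x. X x < \<infinity>)"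

definition closed_function :: "('a::topological_space \<Rightarrow> ereal) \<Rightarrow> bool" where
  "closed_function X \<longleftrightarrow> closed (epigraph X)"

definition convex_function :: "('a::real_vector \<Rightarrow> ereal) \<Rightarrow> bool" where
  "convex_function X \<longleftrightarrow> convex (epigraph X)"

definition prox_map :: "('a::real_inner \<Rightarrow> ereal) \<Rightarrow> 'a \<Rightarrow> 'a \<Rightarrow> real \<Rightarrow> 'a" where
  "prox_map X x y c =
     (SOME u. \<forall>v. ereal (inner y u + (norm (u - x))\<^sup>2 / (2 * c)) + X u
                 \<le> ereal (inner y v + (norm (v - x))\<^sup>2 / (2 * c)) + X v)"

definition grad_map :: "('a::real_inner \<Rightarrow> ereal) \<Rightarrow> 'a \<Rightarrow> 'a \<Rightarrow> real \<Rightarrow> 'a" where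
  "grad_map X x y c = (1 / c) *\<^sub>R (x - prox_map X x y c)"

text \<open>Gamma_1 = 1, Gamma_k = (1 - alpha_k) Gamma_(k-1) for k >= 2
  (the value at 0 is irrelevant and set to 1).\<close>

fun Gam :: "(nat \<Rightarrow> real) \<Rightarrow> nat \<Rightarrow> real" where
  "Gam \<alpha> 0 = 1"
| "Gam \<alpha> (Suc 0) = 1"
| "Gam \<alpha> (Suc (Suc k)) = (1 - \<alpha> (Suc (Suc k))) * Gam \<alpha> (Suc k)"

end

theory Submission
  imports Defs
begin

text \<open>
  The three-point inequalities of the two prox steps, the descent lemma for \<open>f + h\<close>, convexity of \<open>h\<close>
  and the curvature bound of \<open>f\<close> from below combine into a one-step inequality for the objective gap.
  Divided by \<open>\<Gamma>\<close> and summed, it telescopes. The linear noise terms have mean zero because the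
  iterates entering them do not depend on the current samples, and by the same orthogonality the
  mean squared batch error is at most \<open>\<sigma>\<^sup>2 / m\<close>.

  The starting point is not bounded by \<open>M\<close>, so the first step contributes the curvature term
  \<open>Lf / 2 * (norm (x0 - xs))\<^sup>2\<close>, which is missing from the bound to be proved. Since
  \<open>Lf * lam 1 \<le> (Lf + Lh) * \<beta> 1 < 1\<close>, it only doubles the term \<open>(norm (x0 - xs))\<^sup>2 / (2 * lam 1)\<close>;
  this is compensated by the splitting of the noise in \<open>noise_absorption\<close>, which yields twice
  the gradient term needed at the cost of twice the noise term.
\<close>

section \<open>Proximal maps\<close>

locale proper_closed_convex =
  fixes X :: "'a::euclidean_space \<Rightarrow> ereal"
  assumes proper: "proper_function X"
    and closed: "closed_function X"
    and convex: "convex_function X"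
    and bdd: "bounded (effective_domain X)"
begin

abbreviation effdom :: "'a set" where "effdom \<equiv> effective_domain X"

text \<open>Meaningful only on \<open>effdom\<close>: where \<open>X\<close> is infinite,
  \<open>real_of_ereal\<close> returns the default value 0.\<close>

definition val :: "'a \<Rightarrow> real" where "val x = real_of_ereal (X x)"

lemma dom_eq_val: "x \<in> effdom \<Longrightarrow> X x = ereal (val x)"
  using proper unfolding effective_domain_def proper_function_def val_def
  by (cases "X x") auto

lemma not_dom: "x \<notin> effdom \<Longrightarrow> X x = \<infinity>"
  by (auto simp: effective_domain_def)

lemma dom_iff_le: "X x \<le> ereal t \<longleftrightarrow> x \<in> effdom \<and> val x \<le> t"
  by (cases "x \<in> effdom") (auto simp: dom_eq_val not_dom)

lemma dom_nonempty: "effdom \<noteq> {}"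
  using proper by (auto simp: proper_function_def effective_domain_def)

lemma val_convex: "convex_on effdom val"
proof -
  have key: "s *\<^sub>R x + t *\<^sub>R y \<in> effdom \<and> val (s *\<^sub>R x + t *\<^sub>R y) \<le> s * val x + t * val y"
    if "x \<in> effdom" "y \<in> effdom" "0 \<le> s" "0 \<le> t" "s + t = 1" for x y s t
  proof -
    have "(x, val x) \<in> epigraph X" "(y, val y) \<in> epigraph X"
      using that by (auto simp: epigraph_def dom_iff_le)
    then have "s *\<^sub>R (x, val x) + t *\<^sub>R (y, val y) \<in> epigraph X"
      using convex that unfolding convex_function_def convex_def by blast
    then show ?thesis by (simp add: epigraph_def dom_iff_le)
  qed
  have "convex effdom" unfolding convex_def using key by blast
  then show ?thesis unfolding convex_on_def using key by blast
qed

text \<open>The set is the preimage of the closed epigraph under the continuous map sending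
  \<open>v\<close> to \<open>(v, t - q v)\<close>.\<close>

lemma closed_sublevel:
  assumes "continuous_on UNIV q"
  shows "closed {v. ereal (q v) + X v \<le> ereal t}"
proof -
  have "ereal (q v) + X v \<le> ereal t \<longleftrightarrow> (v, t - q v) \<in> epigraph X" for v
    by (cases "X v") (auto simp: epigraph_def)
  then have "{v. ereal (q v) + X v \<le> ereal t} = (\<lambda>v. (v, t - q v)) -` epigraph X"
    by auto
  moreover have "continuous_on UNIV (\<lambda>v. (v, t - q v))"
    by (intro continuous_intros assms)
  ultimately show ?thesis
    using closed closed_vimage unfolding closed_function_def by metis
qed

text \<open>Weierstrass by nested compact sets. Every real sublevel set is closed and lies in the
  bounded domain, those above the infimum are nonempty, and a common point of them attains the
  infimum.\<close>

lemma ex_minimizer: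
  assumes q: "continuous_on UNIV q"
  shows "\<exists>u. \<forall>v. ereal (q u) + X u \<le> ereal (q v) + X v"
proof -
  define F where "F v = ereal (q v) + X v" for v
  define I where "I = (INF v. F v)"
  define C where "C t = {v. F v \<le> ereal t}" for t
  have sub: "C t \<subseteq> effdom" for t
    unfolding C_def F_def using not_dom by fastforce
  have cpt: "compact (C t)" for t
    using closed_sublevel[OF q] bounded_subset[OF bdd sub[of t]]
    unfolding C_def F_def by (simp add: compact_eq_bounded_closed)
  have ne: "C t \<noteq> {}" if "I < ereal t" for t
  proof -
    obtain v where "F v < ereal t"
      using \<open>I < ereal t\<close> unfolding I_def by (auto simp: INF_less_iff)
    then have "v \<in> C t" unfolding C_def by simp
    then show ?thesis by blast
  qed
  have mono: "C s \<subseteq> C t \<or> C t \<subseteq> C s" for s t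
  proof (cases "s \<le> t")
    case True
    then have "ereal s \<le> ereal t" by simp
    then show ?thesis unfolding C_def by (blast intro: order_trans)
  next
    case False
    then have "ereal t \<le> ereal s" by simp
    then show ?thesis unfolding C_def by (blast intro: order_trans)
  qed
  have "\<Inter> (C ` {t. I < ereal t}) \<noteq> {}"
  proof (rule compact_chain)
    show "compact A" if "A \<in> C ` {t. I < ereal t}" for A using that cpt by auto
    show "{} \<notin> C ` {t. I < ereal t}" using ne by (metis imageE mem_Collect_eq)
    show "A \<subseteq> B \<or> B \<subseteq> A"
      if "A \<in> C ` {t. I < ereal t} \<and> B \<in> C ` {t. I < ereal t}" for A B
      using that mono by (metis imageE)
  qed
  then obtain u where u: "\<And>t. I < ereal t \<Longrightarrow> F u \<le> ereal t"
    unfolding C_def by auto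
  have "F u \<le> I"
  proof (rule dense_ge)
    fix z assume "I < z"
    then obtain t where "I < ereal t" "ereal t < z"
      using ereal_dense2 by blast
    then show "F u \<le> z" using u by (meson less_imp_le order_trans)
  qed
  then have "\<forall>v. F u \<le> F v"
    unfolding I_def by (meson INF_lower UNIV_I order_trans)
  then show ?thesis unfolding F_def by blast
qed

lemma prox_map_minimizes:
  fixes c :: real
  shows "ereal (inner y (prox_map X x y c) + (norm (prox_map X x y c - x))\<^sup>2 / (2 * c))
           + X (prox_map X x y c)
         \<le> ereal (inner y v + (norm (v - x))\<^sup>2 / (2 * c)) + X v"
proof -
  \<comment> \<open>At \<open>c = 0\<close> the quotient is 0 by convention, so the penalty is
    continuous for every real \<open>c\<close>, and the compactness argument gives a minimizer
    whatever the sign of \<open>c\<close>.\<close>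
  have "continuous_on UNIV (\<lambda>u. inner y u + (norm (u - x))\<^sup>2 / (2 * c))"
    by (cases "c = 0") (auto intro!: continuous_intros)
  from someI_ex[OF ex_minimizer[OF this]] show ?thesis
    unfolding prox_map_def by blast
qed

lemma prox_map_in_dom: "prox_map X x y c \<in> effdom"
proof (rule ccontr)
  assume "prox_map X x y c \<notin> effdom"
  moreover obtain v where "v \<in> effdom" using dom_nonempty by blast
  ultimately show False
    using prox_map_minimizes[of y x c v] by (simp add: dom_eq_val not_dom)
qed

text \<open>First-order optimality without subgradients: compare \<open>u\<close> with a point at
  fraction \<open>t\<close> of the segment towards \<open>v\<close>, divide by \<open>t\<close> and
  let \<open>t\<close> tend to 0 from the right.\<close>

lemma prox_map_variational:
  fixes x y :: 'a and c :: real
  assumes c: "c > 0" and v: "v \<in> effdom"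
  defines "u \<equiv> prox_map X x y c"
  shows "inner y (u - v) + val u \<le> val v + inner (u - x) (v - u) / c"
proof -
  have udom: "u \<in> effdom" unfolding u_def by (rule prox_map_in_dom)
  \<comment> \<open>Moving from \<open>u\<close> the fraction \<open>t\<close> towards
    \<open>v\<close> changes the prox objective by at most \<open>t * (A + t * B)\<close>:
    \<open>A\<close> is the first-order part and \<open>B\<close> the quadratic remainder of the
    penalty.\<close>
  define A where "A = inner y (v - u) + inner (u - x) (v - u) / c + val v - val u"
  define B where "B = (norm (v - u))\<^sup>2 / (2 * c)"
  have *: "0 \<le> A + t * B" if t: "0 < t" "t < 1" for t
  proof -
    define z where "z = (1 - t) *\<^sub>R u + t *\<^sub>R v"
    have "z \<in> effdom" and "val z \<le> (1 - t) * val u + t * val v"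
      using val_convex udom v t unfolding convex_on_def convex_def z_def by auto
    moreover have "inner y u + (norm (u - x))\<^sup>2 / (2 * c) + val u
        \<le> inner y z + (norm (z - x))\<^sup>2 / (2 * c) + val z"
      using prox_map_minimizes[of y x c z] udom \<open>z \<in> effdom\<close>
      unfolding u_def by (simp add: dom_eq_val)
    moreover have "inner y z = inner y u + t * inner y (v - u)"
      unfolding z_def by (simp add: algebra_simps)
    moreover have "(norm (z - x))\<^sup>2 / (2 * c)
        = (norm (u - x))\<^sup>2 / (2 * c) + t * (inner (u - x) (v - u) / c) + t * (t * B)"
    proof -
      have "z - x = (u - x) + t *\<^sub>R (v - u)" unfolding z_def by (simp add: algebra_simps)
      then have "(norm (z - x))\<^sup>2
          = (norm (u - x))\<^sup>2 + 2 * t * inner (u - x) (v - u) + t * t * (norm (v - u))\<^sup>2"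
        by (simp only: power2_norm_eq_inner) (simp add: inner_commute algebra_simps)
      then show ?thesis using c unfolding B_def by (simp add: field_simps)
    qed
    ultimately have "0 \<le> t * (A + t * B)"
      unfolding A_def by (simp add: algebra_simps)
    then show ?thesis using t by (simp add: zero_le_mult_iff)
  qed
  have "((\<lambda>t. A + t * B) \<longlongrightarrow> A + 0 * B) (at_right 0)"
    by (intro tendsto_intros)
  moreover have "eventually (\<lambda>t. 0 \<le> A + t * B) (at_right 0)"
    unfolding eventually_at_right_field using * by (intro exI[of _ 1]) auto
  ultimately have "0 \<le> A + 0 * B"
    by (intro tendsto_lowerbound) auto
  then show ?thesis unfolding A_def by (simp add: algebra_simps inner_diff_right)
qed

text \<open>The variational inequality with its inner product rewritten by polarization.\<close>

lemma prox_map_three_point: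
  fixes x y :: 'a and c :: real
  assumes c: "c > 0" and v: "v \<in> effdom"
  defines "u \<equiv> prox_map X x y c"
  shows "inner y (u - v) + val u
    \<le> val v + ((norm (x - v))\<^sup>2 - (norm (u - v))\<^sup>2 - (norm (u - x))\<^sup>2) / (2 * c)"
proof -
  have "inner (u - x) (v - u) = ((norm (x - v))\<^sup>2 - (norm (u - v))\<^sup>2 - (norm (u - x))\<^sup>2) / 2"
    unfolding power2_norm_eq_inner by (simp add: inner_commute algebra_simps)
  then show ?thesis
    using prox_map_variational[OF c v, of y x] unfolding u_def by (simp only: divide_divide_eq_left)
qed

text \<open>Each minimizer is tested against the other one. In the sum of the two variational
  inequalities the values of \<open>X\<close> cancel, and Cauchy-Schwarz finishes.\<close>

lemma prox_map_nonexpansive: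
  assumes c: "c > 0"
  shows "norm (prox_map X x y c - prox_map X x' y' c) \<le> norm ((x - c *\<^sub>R y) - (x' - c *\<^sub>R y'))"
proof -
  define u where "u = prox_map X x y c"
  define u' where "u' = prox_map X x' y' c"
  let ?z = "(x - c *\<^sub>R y) - (x' - c *\<^sub>R y')"
  have "inner y (u - u') + val u \<le> val u' + inner (u - x) (u' - u) / c"
    "inner y' (u' - u) + val u' \<le> val u + inner (u' - x') (u - u') / c"
    unfolding u_def u'_def by (intro prox_map_variational c prox_map_in_dom)+
  then have "inner y (u - u') + inner y' (u' - u)
      \<le> (inner (u - x) (u' - u) + inner (u' - x') (u - u')) / c"
    by (simp add: add_divide_distrib)
  then have "c * (inner y (u - u') + inner y' (u' - u))
      \<le> inner (u - x) (u' - u) + inner (u' - x') (u - u')"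
    using c by (simp add: pos_le_divide_eq mult.commute)
  then have "norm (u - u') * norm (u - u') \<le> inner ?z (u - u')"
    unfolding power2_eq_square[symmetric] power2_norm_eq_inner
    by (simp add: inner_commute algebra_simps)
  also have "\<dots> \<le> norm ?z * norm (u - u')" by (rule norm_cauchy_schwarz)
  finally show ?thesis
    unfolding u_def[symmetric] u'_def[symmetric]
    by (cases "u = u'") (auto simp: mult_le_cancel_right)
qed

text \<open>Joint continuity in the point and the gradient is what carries measurability from the
  samples to the iterates.\<close>

lemma continuous_on_prox_map:
  assumes c: "c > 0"
  shows "continuous_on UNIV (\<lambda>p. prox_map X (fst p) (snd p) c)"
proof -
  have "isCont (\<lambda>p. prox_map X (fst p) (snd p) c) q" for q
  proof -
    have "((\<lambda>p. norm ((fst p - c *\<^sub>R snd p) - (fst q - c *\<^sub>R snd q)))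
        \<longlongrightarrow> norm ((fst q - c *\<^sub>R snd q) - (fst q - c *\<^sub>R snd q))) (at q)"
      by (intro tendsto_intros)
    then have "((\<lambda>p. norm ((fst p - c *\<^sub>R snd p) - (fst q - c *\<^sub>R snd q))) \<longlongrightarrow> 0) (at q)"
      by simp
    then have "((\<lambda>p. prox_map X (fst p) (snd p) c - prox_map X (fst q) (snd q) c) \<longlongrightarrow> 0) (at q)"
      by (rule Lim_null_comparison[OF always_eventually, rotated])
        (rule allI, rule prox_map_nonexpansive[OF c])
    then show ?thesis unfolding isCont_def by (rule LIM_zero_cancel)
  qed
  then show ?thesis by (simp add: continuous_at_imp_continuous_on)
qed

lemma measurable_prox_map:
  assumes "c > 0" and x: "x \<in> borel_measurable Q" and y: "y \<in> borel_measurable Q"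
  shows "(\<lambda>\<omega>. prox_map X (x \<omega>) (y \<omega>) c) \<in> borel_measurable Q"
proof -
  have "(\<lambda>\<omega>. (x \<omega>, y \<omega>)) \<in> borel_measurable Q"
    by (intro borel_measurable_Pair x y)
  from measurable_compose[OF this
      borel_measurable_continuous_onI[OF continuous_on_prox_map[OF \<open>c > 0\<close>]]]
  show ?thesis by (simp only: fst_conv snd_conv)
qed

text \<open>The scaling \<open>1 / c\<close> cancels the factor \<open>c\<close> in the
  nonexpansiveness bound, so a noisy gradient displaces the gradient mapping by at most the noise
  itself.\<close>

lemma norm_grad_map_diff_le:
  assumes "c > 0"
  shows "norm (grad_map X x y c - grad_map X x y' c) \<le> norm (y - y')"
proof -
  have "grad_map X x y c - grad_map X x y' c
      = (1 / c) *\<^sub>R (prox_map X x y' c - prox_map X x y c)"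
    unfolding grad_map_def by (simp add: algebra_simps)
  then have "norm (grad_map X x y c - grad_map X x y' c)
      = (1 / c) * norm (prox_map X x y' c - prox_map X x y c)"
    using assms by simp
  also have "\<dots> \<le> (1 / c) * norm ((x - c *\<^sub>R y') - (x - c *\<^sub>R y))"
    using assms by (intro mult_left_mono prox_map_nonexpansive) auto
  also have "(x - c *\<^sub>R y') - (x - c *\<^sub>R y) = c *\<^sub>R (y - y')"
    by (simp add: algebra_simps)
  finally show ?thesis using assms by simp
qed

lemma borel_measurable_X: "X \<in> borel_measurable borel"
proof (rule borel_measurableI_le)
  fix y :: ereal
  show "{x \<in> space borel. X x \<le> y} \<in> sets borel"
  proof (cases y)
    case (real t)
    have "closed {x. X x \<le> ereal t}"
      using closed_sublevel[of "\<lambda>_. 0" t] by (simp flip: zero_ereal_def)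
    then show ?thesis using real by simp
  next
    case MInf
    then show ?thesis using proper by (simp add: proper_function_def)
  qed simp
qed

end

section \<open>The energy inequality along a run\<close>

text \<open>Descent lemma: along the segment, \<open>f\<close> minus its linearization minus the
  quadratic term has a nonpositive derivative, because the Lipschitz bound controls the change of
  the gradient.\<close>

lemma quadratic_upper_bound:
  fixes f :: "'a::real_inner \<Rightarrow> real"
  assumes deriv: "\<And>x. (f has_derivative (\<lambda>v. inner (g x) v)) (at x)"
    and lip: "\<And>x y. norm (g x - g y) \<le> L * norm (x - y)"
  shows "f y \<le> f x + inner (g x) (y - x) + L / 2 * (norm (y - x))\<^sup>2"
proof -
  define d where "d = y - x"
  define p where "p t = f (x + t *\<^sub>R d) - t * inner (g x) d - L / 2 * t\<^sup>2 * (norm d)\<^sup>2" for t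
  have "p 1 \<le> p 0"
  proof (rule DERIV_nonpos_imp_nonincreasing[where f = p])
    fix t :: real assume t: "0 \<le> t" "t \<le> 1"
    have "((\<lambda>t. f (x + t *\<^sub>R d)) has_derivative (\<lambda>s. inner (g (x + t *\<^sub>R d)) (s *\<^sub>R d))) (at t)"
      by (rule has_derivative_compose[OF _ deriv]) (auto intro!: derivative_eq_intros)
    then have "((\<lambda>t. f (x + t *\<^sub>R d)) has_real_derivative inner (g (x + t *\<^sub>R d)) d) (at t)"
      by (simp add: has_field_derivative_def mult_commute_abs)
    then have "(p has_real_derivative
        inner (g (x + t *\<^sub>R d)) d - inner (g x) d - L * t * (norm d)\<^sup>2) (at t)"
      unfolding p_def by (auto intro!: derivative_eq_intros)
    moreover have "inner (g (x + t *\<^sub>R d)) d - inner (g x) d - L * t * (norm d)\<^sup>2 \<le> 0"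
    proof -
      have "inner (g (x + t *\<^sub>R d) - g x) d \<le> norm (g (x + t *\<^sub>R d) - g x) * norm d"
        by (rule norm_cauchy_schwarz)
      also have "\<dots> \<le> L * norm (x + t *\<^sub>R d - x) * norm d"
        by (intro mult_right_mono lip) auto
      finally show ?thesis
        using t by (simp add: inner_diff_left power2_eq_square algebra_simps)
    qed
    ultimately show "\<exists>z. (p has_real_derivative z) (at t) \<and> z \<le> 0" by blast
  qed simp
  then show ?thesis unfolding p_def d_def by simp
qed

lemma quadratic_lower_bound:
  fixes f :: "'a::real_inner \<Rightarrow> real"
  assumes deriv: "\<And>x. (f has_derivative (\<lambda>v. inner (g x) v)) (at x)"
    and lip: "\<And>x y. norm (g x - g y) \<le> L * norm (x - y)"
  shows "f x + inner (g x) (y - x) - L / 2 * (norm (y - x))\<^sup>2 \<le> f y"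
proof -
  have "((\<lambda>x. - f x) has_derivative (\<lambda>v. inner (- g x) v)) (at x)" for x
    using has_derivative_minus[OF deriv[of x]] by (simp only: inner_minus_left)
  moreover have "norm (- g x - - g y) \<le> L * norm (x - y)" for x y
    using lip[of y x] by (simp add: norm_minus_commute)
  ultimately show ?thesis
    using quadratic_upper_bound[of "\<lambda>x. - f x" "\<lambda>x. - g x" L y x] by simp
qed

text \<open>Restricting \<open>h\<close> to the line through \<open>x\<close> and \<open>y\<close>
  reduces this to the tangent inequality in one variable.\<close>

lemma convex_above_tangent:
  fixes h :: "'a::real_inner \<Rightarrow> real"
  assumes cvx: "convex_on UNIV h"
    and deriv: "(h has_derivative (\<lambda>v. inner g v)) (at x)"
  shows "h x + inner g (y - x) \<le> h y"
proof -
  define d where "d = y - x"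
  define p where "p t = h (x + t *\<^sub>R d)" for t :: real
  have "convex_on UNIV p"
  proof (rule convex_onI)
    fix t s r :: real assume t: "0 < t" "t < 1"
    have "x + ((1 - t) *\<^sub>R s + t *\<^sub>R r) *\<^sub>R d = (1 - t) *\<^sub>R (x + s *\<^sub>R d) + t *\<^sub>R (x + r *\<^sub>R d)"
      by (simp add: algebra_simps)
    then show "p ((1 - t) *\<^sub>R s + t *\<^sub>R r) \<le> (1 - t) * p s + t * p r"
      unfolding p_def using convex_onD[OF cvx, of t "x + s *\<^sub>R d" "x + r *\<^sub>R d"] t by simp
  qed simp
  moreover have "(p has_real_derivative inner g d) (at 0)"
  proof -
    have "(p has_derivative (\<lambda>s. inner g (s *\<^sub>R d))) (at 0)"
      unfolding p_def
      by (rule has_derivative_compose[where g = h]) (auto intro!: derivative_eq_intros simp: deriv)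
    then show ?thesis by (simp add: has_field_derivative_def mult_commute_abs)
  qed
  ultimately have "p 1 - p 0 \<ge> inner g d * (1 - 0)"
    by (intro convex_on_imp_above_tangent[where A = UNIV]) auto
  then show ?thesis unfolding p_def d_def by simp
qed

section \<open>One step of the method for the composite objective\<close>

locale composite = proper_closed_convex X
  for X :: "'a::euclidean_space \<Rightarrow> ereal" +
  fixes f h :: "'a \<Rightarrow> real" and gf gh :: "'a \<Rightarrow> 'a" and Lf Lh :: real
  assumes f_deriv: "\<And>x. (f has_derivative (\<lambda>v. inner (gf x) v)) (at x)"
    and f_lip: "\<And>x y. norm (gf x - gf y) \<le> Lf * norm (x - y)"
    and Lf_nonneg: "0 \<le> Lf"
    and h_convex: "convex_on UNIV h"
    and h_deriv: "\<And>x. (h has_derivative (\<lambda>v. inner (gh x) v)) (at x)"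
    and h_lip: "\<And>x y. norm (gh x - gh y) \<le> Lh * norm (x - y)"
    and Lh_nonneg: "0 \<le> Lh"
begin

definition smooth :: "'a \<Rightarrow> real" where "smooth x = f x + h x"
definition grad :: "'a \<Rightarrow> 'a" where "grad x = gf x + gh x"
definition obj :: "'a \<Rightarrow> real" where "obj x = smooth x + val x"

lemma grad_lip: "norm (grad x - grad y) \<le> (Lf + Lh) * norm (x - y)"
proof -
  have "grad x - grad y = (gf x - gf y) + (gh x - gh y)"
    by (simp add: grad_def)
  then have "norm (grad x - grad y) \<le> norm (gf x - gf y) + norm (gh x - gh y)"
    by (metis norm_triangle_ineq)
  then show ?thesis
    using f_lip[of x y] h_lip[of x y] by (simp add: distrib_right)
qed

lemma smooth_deriv: "(smooth has_derivative (\<lambda>v. inner (grad x) v)) (at x)"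
  using has_derivative_add[OF f_deriv h_deriv, of x]
  by (simp add: smooth_def[abs_def] grad_def inner_add_left)

lemma continuous_grad: "continuous_on UNIV grad"
proof -
  have "(Lf + Lh)-lipschitz_on UNIV grad"
    using Lf_nonneg Lh_nonneg grad_lip by (intro lipschitz_onI) (auto simp: dist_norm)
  then show ?thesis by (rule lipschitz_on_continuous_on)
qed

lemma continuous_smooth: "continuous_on UNIV smooth"
  using has_derivative_continuous[OF smooth_deriv] by (simp add: continuous_at_imp_continuous_on)

lemma smooth_upper: "smooth y \<le> smooth x + inner (grad x) (y - x) + (Lf + Lh) / 2 * (norm (y - x))\<^sup>2"
  by (rule quadratic_upper_bound[OF smooth_deriv grad_lip])

text \<open>The convex part \<open>h\<close> lies above its tangents, so only \<open>f\<close> costs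
  curvature from below. This is why the final bound contains \<open>Lf\<close> but not
  \<open>Lh\<close> in its curvature term.\<close>

lemma smooth_lower: "smooth x + inner (grad x) (y - x) - Lf / 2 * (norm (y - x))\<^sup>2 \<le> smooth y"
  using quadratic_lower_bound[OF f_deriv f_lip, of x y]
    convex_above_tangent[OF h_convex h_deriv, of x y]
  by (simp add: smooth_def grad_def inner_add_left)

text \<open>The alternative \<open>a = 1\<close> covers the first iteration, where \<open>ag = x0\<close> may lie outside the domain.\<close>

lemma one_step:
  fixes x ag md xp agp y v :: 'a and a b l :: real
  assumes a: "0 < a" "a \<le> 1" and ag: "a = 1 \<or> ag \<in> effdom" and v: "v \<in> effdom"
    and l: "0 < l" and al: "a * l \<le> b"
    and md: "md = (1 - a) *\<^sub>R ag + a *\<^sub>R x"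
    and xp: "xp = prox_map X x y l"
    and agp: "agp = prox_map X md y b"
  shows "obj agp - obj v
      + (1 - (Lf + Lh) * b) / (2 * b) * (norm (agp - md))\<^sup>2
      + inner (y - grad md) (agp - md) + a * inner (y - grad md) (x - v)
    \<le> (1 - a) * (obj ag - obj v)
      + a / (2 * l) * ((norm (x - v))\<^sup>2 - (norm (xp - v))\<^sup>2)
      + Lf / 2 * (a * (norm (md - v))\<^sup>2 + (1 - a) * a\<^sup>2 * (norm (ag - x))\<^sup>2)"
proof -
  define L where "L = Lf + Lh"
  define g where "g = grad md"
  have b: "0 < b" using a l al mult_pos_pos[of a l] by linarith
  have xpd: "xp \<in> effdom" unfolding xp by (rule prox_map_in_dom)
  \<comment> \<open>The three-point inequality of the second prox step is tested at this point:
    convexity splits its \<open>X\<close>-value into those of \<open>ag\<close> and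
    \<open>xp\<close>, and \<open>md - z\<close> is a multiple of the move \<open>x - xp\<close> of
    the first prox step.\<close>
  define z where "z = (1 - a) *\<^sub>R ag + a *\<^sub>R xp"
  have z: "z \<in> effdom \<and> val z \<le> (1 - a) * val ag + a * val xp"
  proof (cases "a = 1")
    case True
    then show ?thesis using xpd by (simp add: z_def)
  next
    case False
    then show ?thesis
      using val_convex a ag xpd unfolding convex_on_def convex_def z_def by auto
  qed
  have "inner y (xp - v) + val xp
    \<le> val v + ((norm (x - v))\<^sup>2 - (norm (xp - v))\<^sup>2 - (norm (xp - x))\<^sup>2) / (2 * l)"
    unfolding xp by (rule prox_map_three_point[OF l v])
  from mult_left_mono[OF this, of a]
  have 1: "a * inner y (xp - v) + a * val xp
    \<le> a * val v + a / (2 * l) * ((norm (x - v))\<^sup>2 - (norm (xp - v))\<^sup>2)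
        - a / (2 * l) * (norm (xp - x))\<^sup>2"
    using a by (simp add: algebra_simps diff_divide_distrib add_divide_distrib)
  have "inner y (agp - z) + val agp
    \<le> val z + ((norm (md - z))\<^sup>2 - (norm (agp - z))\<^sup>2 - (norm (agp - md))\<^sup>2) / (2 * b)"
    unfolding agp using z by (intro prox_map_three_point[OF b]) auto
  moreover have "\<dots> \<le> val z + ((norm (md - z))\<^sup>2 - (norm (agp - md))\<^sup>2) / (2 * b)"
    using b by (simp add: divide_right_mono)
  moreover have "md - z = a *\<^sub>R (x - xp)"
    unfolding md z_def by (simp add: algebra_simps)
  ultimately have 2: "inner y (agp - z) + val agp
    \<le> (1 - a) * val ag + a * val xp
      + a\<^sup>2 / (2 * b) * (norm (xp - x))\<^sup>2 - (norm (agp - md))\<^sup>2 / (2 * b)"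
    using z by (simp add: power_mult_distrib diff_divide_distrib norm_minus_commute)
  \<comment> \<open>The condition \<open>a * l \<le> b\<close> lets the quadratic gain of the first
    prox step pay for the distance \<open>md - z\<close> in the second.\<close>
  have "a\<^sup>2 / (2 * b) \<le> a / (2 * l)"
    using mult_left_mono[OF al, of a] a b l by (simp add: field_simps power2_eq_square)
  then have 3: "a\<^sup>2 / (2 * b) * (norm (xp - x))\<^sup>2 \<le> a / (2 * l) * (norm (xp - x))\<^sup>2"
    by (intro mult_right_mono) auto
  have 4: "smooth agp \<le> smooth md + inner g (agp - md) + L / 2 * (norm (agp - md))\<^sup>2"
    unfolding g_def L_def by (rule smooth_upper)
  have 5: "a * (smooth md + inner g (v - md) - Lf / 2 * (norm (md - v))\<^sup>2) \<le> a * smooth v"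
    unfolding g_def using a smooth_lower[of md v]
    by (intro mult_left_mono) (auto simp: norm_minus_commute)
  have 6: "(1 - a) * (smooth md + inner g (ag - md) - Lf / 2 * (a\<^sup>2 * (norm (ag - x))\<^sup>2))
      \<le> (1 - a) * smooth ag"
  proof -
    have "ag - md = a *\<^sub>R (ag - x)" unfolding md by (simp add: algebra_simps)
    then show ?thesis
      unfolding g_def using a smooth_lower[of md ag]
      by (intro mult_left_mono) (auto simp: power_mult_distrib)
  qed
  \<comment> \<open>The new point \<open>xp\<close> cancels, leaving \<open>x\<close>, which was
    fixed before \<open>y\<close> was drawn. Together with the same combination for the exact
    gradient in 8, only the error \<open>y - g\<close> survives, paired with \<open>x - v\<close>
    and with \<open>agp - md\<close>.\<close>
  have 7: "inner y (agp - z) + a * inner y (xp - v) = inner y (agp - md) + a * inner y (x - v)"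
    unfolding z_def md by (simp add: algebra_simps)
  have 8: "a * inner g (v - md) + (1 - a) * inner g (ag - md) = - (a * inner g (x - v))"
  proof -
    have "a *\<^sub>R (v - md) + (1 - a) *\<^sub>R (ag - md) = - (a *\<^sub>R (x - v))"
      unfolding md by (simp add: algebra_simps)
    then have "inner g (a *\<^sub>R (v - md) + (1 - a) *\<^sub>R (ag - md)) = inner g (- (a *\<^sub>R (x - v)))"
      by simp
    then show ?thesis by (simp only: inner_add_right inner_scaleR_right inner_minus_right)
  qed
  have 9: "(1 - L * b) / (2 * b) * (norm (agp - md))\<^sup>2
      = (norm (agp - md))\<^sup>2 / (2 * b) - L / 2 * (norm (agp - md))\<^sup>2"
    using b by (simp add: field_simps)
  show ?thesis
    unfolding L_def[symmetric] g_def[symmetric] 9 obj_def inner_diff_left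
    using 1 2 3 4 5 6 7 8
    by (simp add: algebra_simps diff_divide_distrib add_divide_distrib)
qed

end

section \<open>Positivity of the weights and absorption of the noise\<close>

lemma Gam_Suc: "1 \<le> k \<Longrightarrow> Gam \<alpha> (Suc k) = (1 - \<alpha> (Suc k)) * Gam \<alpha> k"
  by (cases k) auto

lemma Gam_pos:
  assumes "\<And>k. k \<ge> 2 \<Longrightarrow> \<alpha> k < 1"
  shows "0 < Gam \<alpha> k"
  using assms by (induction \<alpha> k rule: Gam.induct) auto

text \<open>Used with \<open>u\<close> the move from \<open>md\<close> to \<open>ag\<close>,
  \<open>d\<close> the gradient error, \<open>G\<close> the negated exact gradient mapping and
  \<open>a\<close> the factor \<open>gap\<close>. The triangle inequality and Cauchy-Schwarz reduce
  the claim to a quadratic inequality in the scalars \<open>U\<close> and \<open>t\<close>.\<close>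

lemma noise_absorption:
  fixes u d G :: "'a::real_inner" and a b :: real
  assumes a: "0 < a" "a \<le> 1" and b: "0 < b"
    and G: "norm (G - (1 / b) *\<^sub>R u) \<le> norm d"
  shows "a * b / 4 * (norm G)\<^sup>2
      \<le> a / (2 * b) * (norm u)\<^sup>2 + inner d u + b * (4 + a\<^sup>2) / (2 * a) * (norm d)\<^sup>2"
proof -
  define U where "U = norm u / b"
  define t where "t = norm d"
  have nu: "norm u = b * U" using b by (simp add: U_def)
  have U: "0 \<le> U" "0 \<le> t" using b by (auto simp: U_def t_def)
  have "norm G \<le> norm (G - (1 / b) *\<^sub>R u) + norm ((1 / b) *\<^sub>R u)"
    by (metis norm_triangle_sub add.commute)
  then have "norm G \<le> U + t" using G b by (simp add: U_def t_def)
  then have "(norm G)\<^sup>2 \<le> (U + t)\<^sup>2" by (simp add: power_mono)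
  then have 1: "a * b / 4 * (norm G)\<^sup>2 \<le> a * b / 4 * (U + t)\<^sup>2"
    using a b by (intro mult_left_mono) auto
  have 2: "- (b * (t * U)) \<le> inner d u"
    using Cauchy_Schwarz_ineq2[of d u] nu by (simp add: t_def ac_simps)
  have "a / 4 * (U + t)\<^sup>2 \<le> a / 2 * U\<^sup>2 - t * U + (4 + a\<^sup>2) / (2 * a) * t\<^sup>2"
  proof -
    have "a\<^sup>2 \<le> a" using a by (simp add: power2_eq_square mult_left_le)
    then have "a\<^sup>2 * t\<^sup>2 \<le> a * t\<^sup>2" by (intro mult_right_mono) auto
    moreover have "a * t\<^sup>2 \<le> 1 * t\<^sup>2" using a by (intro mult_right_mono) auto
    \<comment> \<open>In the inequality below, right side minus left side equals this square plus
      \<open>4 * (1 - a) * t\<^sup>2\<close>, which is nonnegative because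
      \<open>a \<le> 1\<close>.\<close>
    moreover have "0 \<le> (a * U - (2 + a) * t)\<^sup>2" by simp
    ultimately have "a * (a * (U + t)\<^sup>2) \<le> a * (2 * a * U\<^sup>2 - 4 * t * U) + 2 * (4 + a\<^sup>2) * t\<^sup>2"
      by (simp add: power2_eq_square algebra_simps)
    then show ?thesis using a by (simp add: field_simps power2_eq_square)
  qed
  from mult_left_mono[OF this, of b]
  have "a * b / 4 * (U + t)\<^sup>2 \<le> a / 2 * b * U\<^sup>2 - b * (t * U) + b * (4 + a\<^sup>2) / (2 * a) * t\<^sup>2"
    using b by (simp add: algebra_simps)
  moreover have "a / (2 * b) * (norm u)\<^sup>2 = a / 2 * b * U\<^sup>2"
    using b unfolding nu by (simp add: field_simps power2_eq_square)
  ultimately show ?thesis using 1 2 unfolding t_def by linarith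
qed

text \<open>Counterpart for the objective gap, where no gradient term has to be kept. Completing the
  square asks for the coefficient \<open>b / (2 * a)\<close> only; it is enlarged to match the noise
  term of the bound to be proved.\<close>

lemma young_absorption:
  fixes u d :: "'a::real_inner" and a b :: real
  assumes a: "0 < a" and b: "0 < b"
  shows "0 \<le> a / (2 * b) * (norm u)\<^sup>2 + inner d u + b * (4 + a\<^sup>2) / (4 * a) * (norm d)\<^sup>2"
proof -
  have "0 \<le> (norm (a *\<^sub>R u + b *\<^sub>R d))\<^sup>2" by simp
  also have "\<dots> = a\<^sup>2 * (norm u)\<^sup>2 + 2 * a * b * inner d u + b\<^sup>2 * (norm d)\<^sup>2"
    unfolding power2_norm_eq_inner by (simp add: algebra_simps inner_commute power2_eq_square)
  also have "\<dots> = 2 * a * b * (a / (2 * b) * (norm u)\<^sup>2 + inner d u + b / (2 * a) * (norm d)\<^sup>2)"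
    using a b by (simp add: field_simps power2_eq_square)
  finally have "0 \<le> a / (2 * b) * (norm u)\<^sup>2 + inner d u + b / (2 * a) * (norm d)\<^sup>2"
    using mult_pos_pos[OF a b] by (subst (asm) zero_le_mult_iff) linarith
  moreover have "b / (2 * a) \<le> b * (4 + a\<^sup>2) / (4 * a)"
    using a b by (simp add: field_simps)
  then have "b / (2 * a) * (norm d)\<^sup>2 \<le> b * (4 + a\<^sup>2) / (4 * a) * (norm d)\<^sup>2"
    by (intro mult_right_mono) auto
  ultimately show ?thesis by linarith
qed

section \<open>The telescoped energy inequality\<close>

locale rsag_parameters = composite X f h gf gh Lf Lh
  for X :: "'a::euclidean_space \<Rightarrow> ereal" and f h gf gh Lf Lh +
  fixes M :: real and xs :: 'a and \<alpha> \<beta> lam :: "nat \<Rightarrow> real"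
  assumes M_bound: "\<And>x y c. c > 0 \<Longrightarrow> norm (prox_map X x y c) \<le> M"
    and \<alpha>1: "\<alpha> 1 = 1"
    and \<alpha>_range: "\<And>k. k \<ge> 2 \<Longrightarrow> 0 < \<alpha> k \<and> \<alpha> k < 1"
    and \<beta>_pos: "\<And>k. k \<ge> 1 \<Longrightarrow> \<beta> k > 0"
    and lam_pos: "\<And>k. k \<ge> 1 \<Longrightarrow> lam k > 0"
    and step1: "\<And>k. k \<ge> 1 \<Longrightarrow> \<alpha> k * lam k \<le> \<beta> k"
    and step2: "\<And>k. k \<ge> 1 \<Longrightarrow> (Lf + Lh) * \<beta> k < 1"
    and step_mono: "\<And>k. k \<ge> 1 \<Longrightarrow>
        \<alpha> (Suc k) / (lam (Suc k) * Gam \<alpha> (Suc k)) \<le> \<alpha> k / (lam k * Gam \<alpha> k)"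
    and xs_dom: "xs \<in> effdom"
    and xs_opt: "\<And>x. x \<in> effdom \<Longrightarrow> obj xs \<le> obj x"
begin

abbreviation \<Gamma> :: "nat \<Rightarrow> real" where "\<Gamma> \<equiv> Gam \<alpha>"

definition gap :: "nat \<Rightarrow> real" where "gap k = 1 - (Lf + Lh) * \<beta> k"

lemma gap_pos: "1 \<le> k \<Longrightarrow> 0 < gap k"
  using step2 by (simp add: gap_def)

lemma gap_le_1: "1 \<le> k \<Longrightarrow> gap k \<le> 1"
  using \<beta>_pos[of k] Lf_nonneg Lh_nonneg by (simp add: gap_def)

lemma Gamma_pos [simp]: "0 < \<Gamma> k"
  using \<alpha>_range by (intro Gam_pos) auto

lemma Gamma_nonzero [simp]: "\<Gamma> k \<noteq> 0"
  using Gamma_pos[of k] by linarith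

text \<open>A deterministic trajectory with arbitrary gradient estimates \<open>y\<close>, so that
  the estimates hold for every sample separately and expectations are taken only afterwards.\<close>

definition rsag_run :: "'a \<Rightarrow> (nat \<Rightarrow> 'a) \<Rightarrow> (nat \<Rightarrow> 'a) \<Rightarrow> (nat \<Rightarrow> 'a) \<Rightarrow> (nat \<Rightarrow> 'a) \<Rightarrow> bool" where
  "rsag_run x0 x ag md y \<longleftrightarrow> x 0 = x0 \<and> ag 0 = x0 \<and>
    (\<forall>k\<ge>1. md k = (1 - \<alpha> k) *\<^sub>R ag (k - 1) + \<alpha> k *\<^sub>R x (k - 1)
        \<and> x k = prox_map X (x (k - 1)) (y k) (lam k)
        \<and> ag k = prox_map X (md k) (y k) (\<beta> k))"

text \<open>Sum of the one-step inequalities divided by \<open>\<Gamma> k\<close>. The objective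
  gaps telescope by the recursion for \<open>\<Gamma>\<close>, the distances because their weights
  do not increase, and the weights of the curvature terms after the first step add up to
  \<open>1 / \<Gamma> n - 1\<close>.\<close>

lemma rsag_energy:
  assumes run: "rsag_run x0 x ag md y" and n: "1 \<le> n"
  defines "d \<equiv> \<lambda>k. y k - grad (md k)"
  defines "r \<equiv> norm (x0 - xs)"
  shows "(obj (ag n) - obj xs) / \<Gamma> n + \<alpha> n / (lam n * \<Gamma> n) * (norm (x n - xs))\<^sup>2 / 2
      + (\<Sum>k=1..n. (gap k / (2 * \<beta> k) * (norm (ag k - md k))\<^sup>2 + inner (d k) (ag k - md k)
            + \<alpha> k * inner (d k) (x (k - 1) - xs)) / \<Gamma> k)
    \<le> r\<^sup>2 / (2 * lam 1) + Lf / 2 * r\<^sup>2 + Lf * (1 / \<Gamma> n - 1) * ((norm xs)\<^sup>2 + M\<^sup>2)"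
  using n
proof (induction n rule: nat_induct_at_least)
  case base
  have md: "md 1 = (1 - \<alpha> 1) *\<^sub>R ag 0 + \<alpha> 1 *\<^sub>R x 0"
    and xp: "x 1 = prox_map X (x 0) (y 1) (lam 1)"
    and ag: "ag 1 = prox_map X (md 1) (y 1) (\<beta> 1)"
    and x0: "x 0 = x0"
    using run[unfolded rsag_run_def] by (auto dest!: spec[of _ "1::nat"])
  \<comment> \<open>As \<open>\<alpha> 1 = 1\<close>, the objective at \<open>ag 0\<close> gets
    coefficient 0, and the curvature term of this step is \<open>Lf / 2 * r\<^sup>2\<close>.\<close>
  have "md 1 = x0" using md x0 by (simp add: \<alpha>1[simplified])
  have "obj (ag 1) - obj xs
      + (1 - (Lf + Lh) * \<beta> 1) / (2 * \<beta> 1) * (norm (ag 1 - md 1))\<^sup>2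
      + inner (y 1 - grad (md 1)) (ag 1 - md 1) + \<alpha> 1 * inner (y 1 - grad (md 1)) (x 0 - xs)
    \<le> (1 - \<alpha> 1) * (obj (ag 0) - obj xs)
      + \<alpha> 1 / (2 * lam 1) * ((norm (x 0 - xs))\<^sup>2 - (norm (x 1 - xs))\<^sup>2)
      + Lf / 2 * (\<alpha> 1 * (norm (md 1 - xs))\<^sup>2 + (1 - \<alpha> 1) * (\<alpha> 1)\<^sup>2 * (norm (ag 0 - x 0))\<^sup>2)"
    using \<alpha>1 lam_pos[of 1] step1[of 1] xs_dom by (intro one_step[OF _ _ _ _ _ _ md xp ag]) auto
  then show ?case
    using \<open>md 1 = x0\<close>
    by (simp add: \<alpha>1[simplified] x0 d_def r_def gap_def diff_divide_distrib right_diff_distrib algebra_simps)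
next
  case (Suc n)
  let ?k = "Suc n"
  let ?A = "\<lambda>n. obj (ag n) - obj xs"
  let ?T = "\<lambda>k. gap k / (2 * \<beta> k) * (norm (ag k - md k))\<^sup>2 + inner (d k) (ag k - md k)
            + \<alpha> k * inner (d k) (x (k - 1) - xs)"
  have md: "md ?k = (1 - \<alpha> ?k) *\<^sub>R ag n + \<alpha> ?k *\<^sub>R x n"
    and xp: "x ?k = prox_map X (x n) (y ?k) (lam ?k)"
    and agk: "ag ?k = prox_map X (md ?k) (y ?k) (\<beta> ?k)"
    using run[unfolded rsag_run_def] by (auto dest!: spec[of _ ?k])
  have xn: "x n = prox_map X (x (n - 1)) (y n) (lam n)"
    and agn: "ag n = prox_map X (md n) (y n) (\<beta> n)"
    using run[unfolded rsag_run_def] Suc.hyps by auto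
  have bx: "norm (x n) \<le> M" "norm (ag n) \<le> M"
    unfolding xn agn using M_bound lam_pos \<beta>_pos Suc.hyps by auto
  have a: "0 < \<alpha> ?k" "\<alpha> ?k < 1" using \<alpha>_range[of ?k] Suc.hyps by auto
  have G: "\<Gamma> ?k = (1 - \<alpha> ?k) * \<Gamma> n" by (rule Gam_Suc[OF Suc.hyps])
  \<comment> \<open>The recursion for \<open>\<Gamma>\<close> turns the curvature weight into a
    difference, so that these weights telescope.\<close>
  have dif: "\<alpha> ?k / \<Gamma> ?k = 1 / \<Gamma> ?k - 1 / \<Gamma> n"
  proof -
    have "1 / \<Gamma> n = (1 - \<alpha> ?k) / \<Gamma> ?k" unfolding G using a by simp
    then show ?thesis by (simp add: diff_divide_distrib)
  qed
  have "?A ?k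
      + (1 - (Lf + Lh) * \<beta> ?k) / (2 * \<beta> ?k) * (norm (ag ?k - md ?k))\<^sup>2
      + inner (y ?k - grad (md ?k)) (ag ?k - md ?k) + \<alpha> ?k * inner (y ?k - grad (md ?k)) (x n - xs)
    \<le> (1 - \<alpha> ?k) * ?A n
      + \<alpha> ?k / (2 * lam ?k) * ((norm (x n - xs))\<^sup>2 - (norm (x ?k - xs))\<^sup>2)
      + Lf / 2 * (\<alpha> ?k * (norm (md ?k - xs))\<^sup>2 + (1 - \<alpha> ?k) * (\<alpha> ?k)\<^sup>2 * (norm (ag n - x n))\<^sup>2)"
    using a lam_pos[of ?k] step1[of ?k] xs_dom prox_map_in_dom[of "md n" "y n" "\<beta> n"] agn
    by (intro one_step[OF _ _ _ _ _ _ md xp agk]) auto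
  moreover have "Lf / 2 * (\<alpha> ?k * (norm (md ?k - xs))\<^sup>2 + (1 - \<alpha> ?k) * (\<alpha> ?k)\<^sup>2 * (norm (ag n - x n))\<^sup>2)
     \<le> Lf * \<alpha> ?k * ((norm xs)\<^sup>2 + M\<^sup>2)"
  proof -
    have "(norm (md ?k - xs))\<^sup>2 \<le> 2 * (norm xs)\<^sup>2 + 2 * (norm (md ?k))\<^sup>2"
    proof -
      have "(norm (md ?k - xs))\<^sup>2 + (norm (md ?k + xs))\<^sup>2 = 2 * (norm xs)\<^sup>2 + 2 * (norm (md ?k))\<^sup>2"
        unfolding power2_norm_eq_inner by (simp add: algebra_simps inner_commute)
      then show ?thesis using zero_le_power2[of "norm (md ?k + xs)"] by linarith
    qed
    \<comment> \<open>The variance identity of a convex combination: the spread of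
      \<open>ag n\<close> and \<open>x n\<close> is paid out of the convexity of the squared norm,
      so both curvature terms together are bounded through \<open>M\<close> and
      \<open>xs\<close>.\<close>
    moreover have "(norm (md ?k))\<^sup>2 + (1 - \<alpha> ?k) * \<alpha> ?k * (norm (ag n - x n))\<^sup>2
        = (1 - \<alpha> ?k) * (norm (ag n))\<^sup>2 + \<alpha> ?k * (norm (x n))\<^sup>2"
      unfolding md power2_norm_eq_inner
      by (simp add: algebra_simps inner_commute power2_eq_square)
    moreover have "(1 - \<alpha> ?k) * (norm (ag n))\<^sup>2 + \<alpha> ?k * (norm (x n))\<^sup>2 \<le> (1 - \<alpha> ?k) * M\<^sup>2 + \<alpha> ?k * M\<^sup>2"
      using a bx by (intro add_mono mult_left_mono power_mono) auto
    moreover have "0 \<le> (1 - \<alpha> ?k) * \<alpha> ?k * (norm (ag n - x n))\<^sup>2" using a by simp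
    ultimately have "(norm (md ?k - xs))\<^sup>2 + (1 - \<alpha> ?k) * \<alpha> ?k * (norm (ag n - x n))\<^sup>2
        \<le> 2 * ((norm xs)\<^sup>2 + M\<^sup>2)"
      by (simp add: left_diff_distrib)
    from mult_left_mono[OF this, of "Lf / 2 * \<alpha> ?k"] show ?thesis
      using a Lf_nonneg by (simp add: algebra_simps power2_eq_square)
  qed
  ultimately have step: "?A ?k + ?T ?k
    \<le> (1 - \<alpha> ?k) * ?A n
      + \<alpha> ?k / (2 * lam ?k) * ((norm (x n - xs))\<^sup>2 - (norm (x ?k - xs))\<^sup>2)
      + Lf * \<alpha> ?k * ((norm xs)\<^sup>2 + M\<^sup>2)"
    by (simp add: d_def gap_def)
  have main: "?A ?k / \<Gamma> ?k + ?T ?k / \<Gamma> ?k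
    \<le> ?A n / \<Gamma> n + \<alpha> ?k / (lam ?k * \<Gamma> ?k) * (norm (x n - xs))\<^sup>2 / 2
      - \<alpha> ?k / (lam ?k * \<Gamma> ?k) * (norm (x ?k - xs))\<^sup>2 / 2
      + Lf * (\<alpha> ?k / \<Gamma> ?k) * ((norm xs)\<^sup>2 + M\<^sup>2)"
  proof -
    have "(1 - \<alpha> ?k) * ?A n / \<Gamma> ?k = ?A n / \<Gamma> n"
      unfolding G using a by simp
    moreover have "\<alpha> ?k / (2 * lam ?k) * ((norm (x n - xs))\<^sup>2 - (norm (x ?k - xs))\<^sup>2) / \<Gamma> ?k
      = \<alpha> ?k / (lam ?k * \<Gamma> ?k) * (norm (x n - xs))\<^sup>2 / 2
      - \<alpha> ?k / (lam ?k * \<Gamma> ?k) * (norm (x ?k - xs))\<^sup>2 / 2"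
      by (simp add: right_diff_distrib diff_divide_distrib ac_simps)
    moreover note divide_right_mono[OF step less_imp_le[OF Gamma_pos[of ?k]]]
    ultimately show ?thesis
      by (simp only: add_divide_distrib) simp
  qed
  \<comment> \<open>The monotone step ratios make the distance term left over from step
    \<open>n\<close> large enough to cover the one that the new step introduces.\<close>
  have dist: "\<alpha> ?k / (lam ?k * \<Gamma> ?k) * (norm (x n - xs))\<^sup>2
      \<le> \<alpha> n / (lam n * \<Gamma> n) * (norm (x n - xs))\<^sup>2"
    using step_mono[OF Suc.hyps] by (intro mult_right_mono) auto
  have curv: "Lf * (1 / \<Gamma> n - 1) * ((norm xs)\<^sup>2 + M\<^sup>2) + Lf * (\<alpha> ?k / \<Gamma> ?k) * ((norm xs)\<^sup>2 + M\<^sup>2)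
      = Lf * (1 / \<Gamma> ?k - 1) * ((norm xs)\<^sup>2 + M\<^sup>2)"
    unfolding dif by (simp add: algebra_simps)
  have sum: "(\<Sum>k=1..?k. ?T k / \<Gamma> k) = (\<Sum>k=1..n. ?T k / \<Gamma> k) + ?T ?k / \<Gamma> ?k"
    by simp
  have arith: "A' + q / 2 + (s + t) \<le> c + c3"
    if "A' + t \<le> A + p / 2 - q / 2 + c2" "p \<le> p'" "c1 + c2 = c3" "A + p' / 2 + s \<le> c + c1"
    for A A' p p' q s t c c1 c2 c3 :: real
    using that by simp
  show ?case unfolding sum by (rule arith[OF main dist curv Suc.IH])
qed

end

section \<open>Bounds for the gradient mapping and the objective gap along a run\<close>

context rsag_parameters
begin

text \<open>The summand of the noise sums in the final bounds, up to the factors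
  \<open>\<sigma>\<^sup>2\<close> and \<open>1 / real (m k)\<close>.\<close>

definition noise_coeff :: "nat \<Rightarrow> real" where
  "noise_coeff k = \<beta> k * (4 + (gap k)\<^sup>2) / (4 * \<Gamma> k * gap k)"

lemma noise_coeff_nonneg: "1 \<le> k \<Longrightarrow> 0 \<le> noise_coeff k"
  using gap_pos[of k] \<beta>_pos[of k] less_imp_le[OF Gamma_pos[of k]] by (simp add: noise_coeff_def)

text \<open>\<open>noise_absorption\<close> trades the quadratic and error terms of the energy
  inequality for the exact gradient mapping. The remaining objective gap and distance are
  nonnegative and are dropped, the former by optimality of \<open>xs\<close>.\<close>

lemma grad_map_sum_le:
  assumes run: "rsag_run x0 x ag md y" and n: "1 \<le> n"
  defines "d \<equiv> \<lambda>k. y k - grad (md k)"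
  shows "(\<Sum>k=1..n. \<beta> k * gap k / \<Gamma> k * (norm (grad_map X (md k) (grad (md k)) (\<beta> k)))\<^sup>2)
    \<le> 4 * ((norm (x0 - xs))\<^sup>2 / lam 1 + Lf * (1 / \<Gamma> n - 1) * ((norm xs)\<^sup>2 + M\<^sup>2)
        + (\<Sum>k=1..n. 2 * noise_coeff k * (norm (d k))\<^sup>2 - \<alpha> k / \<Gamma> k * inner (d k) (x (k - 1) - xs)))"
proof -
  let ?T = "\<lambda>k. (gap k / (2 * \<beta> k) * (norm (ag k - md k))\<^sup>2 + inner (d k) (ag k - md k)
            + \<alpha> k * inner (d k) (x (k - 1) - xs)) / \<Gamma> k"
  let ?G = "\<lambda>k. grad_map X (md k) (grad (md k)) (\<beta> k)"
  let ?w = "\<lambda>k. \<beta> k * gap k / \<Gamma> k * (norm (?G k))\<^sup>2"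
  let ?s = "\<lambda>k. 2 * noise_coeff k * (norm (d k))\<^sup>2 - \<alpha> k / \<Gamma> k * inner (d k) (x (k - 1) - xs)"
  have agk: "ag k = prox_map X (md k) (y k) (\<beta> k)" if "1 \<le> k" for k
    using run that by (auto simp: rsag_run_def)
  have summand: "?w k / 4 \<le> ?T k + ?s k" if k: "1 \<le> k" for k
  proof -
    have b: "0 < \<beta> k" using \<beta>_pos k .
    \<comment> \<open>The sign is reversed because \<open>ag k - md k\<close> is
      \<open>- \<beta> k\<close> times the gradient mapping at the noisy gradient. The two mappings
      share the point \<open>md k\<close>, so they differ by at most the error.\<close>
    have "- ?G k - (1 / \<beta> k) *\<^sub>R (ag k - md k) = grad_map X (md k) (y k) (\<beta> k) - ?G k"
      unfolding agk[OF k] grad_map_def by (simp add: algebra_simps)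
    then have "norm (- ?G k - (1 / \<beta> k) *\<^sub>R (ag k - md k)) \<le> norm (d k)"
      using norm_grad_map_diff_le[OF b] by (simp only: d_def)
    from noise_absorption[OF gap_pos[OF k] gap_le_1[OF k] b this]
    have "gap k * \<beta> k / 4 * (norm (?G k))\<^sup>2
      \<le> gap k / (2 * \<beta> k) * (norm (ag k - md k))\<^sup>2 + inner (d k) (ag k - md k)
        + \<beta> k * (4 + (gap k)\<^sup>2) / (2 * gap k) * (norm (d k))\<^sup>2" by simp
    from divide_right_mono[OF this less_imp_le[OF Gamma_pos[of k]]]
    have "gap k * \<beta> k / 4 * (norm (?G k))\<^sup>2 / \<Gamma> k
      \<le> (gap k / (2 * \<beta> k) * (norm (ag k - md k))\<^sup>2 + inner (d k) (ag k - md k)) / \<Gamma> k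
        + \<beta> k * (4 + (gap k)\<^sup>2) / (2 * gap k) * (norm (d k))\<^sup>2 / \<Gamma> k"
      by (simp only: add_divide_distrib)
    moreover have "\<beta> k * (4 + (gap k)\<^sup>2) / (2 * gap k) * (norm (d k))\<^sup>2 / \<Gamma> k
        = 2 * noise_coeff k * (norm (d k))\<^sup>2"
    proof -
      have "gap k \<noteq> 0" using gap_pos[OF k] by linarith
      then show ?thesis by (simp add: noise_coeff_def field_simps)
    qed
    ultimately show ?thesis
      by (simp add: add_divide_distrib ac_simps)
  qed
  have "(\<Sum>k=1..n. ?w k) / 4 \<le> (\<Sum>k=1..n. ?T k + ?s k)"
    unfolding sum_divide_distrib by (intro sum_mono summand) auto
  then have 1: "(\<Sum>k=1..n. ?w k) / 4 \<le> (\<Sum>k=1..n. ?T k) + (\<Sum>k=1..n. ?s k)"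
    by (simp only: sum.distrib)
  have agn: "0 \<le> (obj (ag n) - obj xs) / \<Gamma> n"
    using xs_opt prox_map_in_dom less_imp_le[OF Gamma_pos[of n]] unfolding agk[OF n] by simp
  have "0 \<le> \<alpha> n"
    using \<alpha>1 \<alpha>_range[of n] n by (cases "n = 1") auto
  then have xn: "0 \<le> \<alpha> n / (lam n * \<Gamma> n) * (norm (x n - xs))\<^sup>2 / 2"
    using lam_pos[OF n] less_imp_le[OF Gamma_pos[of n]] by simp
  \<comment> \<open>From here \<open>Lf \<le> 1 / lam 1\<close> follows, so the curvature term of
    the first step is no larger than the initial distance term.\<close>
  have "lam 1 \<le> \<beta> 1" using step1[of 1] \<alpha>1 by simp
  then have "Lf * lam 1 \<le> (Lf + Lh) * \<beta> 1"
    using Lf_nonneg Lh_nonneg lam_pos[of 1] by (intro mult_mono) auto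
  then have "Lf \<le> 1 / lam 1"
    using step2[of 1] lam_pos[of 1] by (simp add: pos_le_divide_eq)
  then have "Lf * (norm (x0 - xs))\<^sup>2 \<le> 1 / lam 1 * (norm (x0 - xs))\<^sup>2"
    by (intro mult_right_mono) auto
  then have "(norm (x0 - xs))\<^sup>2 / (2 * lam 1) + Lf / 2 * (norm (x0 - xs))\<^sup>2 \<le> (norm (x0 - xs))\<^sup>2 / lam 1"
    using lam_pos[of 1] by (simp add: field_simps)
  with rsag_energy[OF run n, folded d_def] agn xn
  have "(\<Sum>k=1..n. ?T k)
      \<le> (norm (x0 - xs))\<^sup>2 / lam 1 + Lf * (1 / \<Gamma> n - 1) * ((norm xs)\<^sup>2 + M\<^sup>2)"
    by (simp only: d_def)
  moreover have "S \<le> 4 * (c + s)" if "S / 4 \<le> T + s" "T \<le> c" for S T c s :: real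
    using that by simp
  ultimately show ?thesis using 1 by blast
qed

text \<open>With \<open>Lf = 0\<close> all curvature terms of the energy inequality vanish. The
  objective gap is kept, and \<open>young_absorption\<close> removes the error terms paired with
  \<open>ag k - md k\<close>.\<close>

lemma obj_gap_le:
  assumes run: "rsag_run x0 x ag md y" and n: "1 \<le> n" and Lf: "Lf = 0"
  defines "d \<equiv> \<lambda>k. y k - grad (md k)"
  shows "obj (ag n) - obj xs \<le> \<Gamma> n * ((norm (x0 - xs))\<^sup>2 / (2 * lam 1)
        + (\<Sum>k=1..n. noise_coeff k * (norm (d k))\<^sup>2 - \<alpha> k / \<Gamma> k * inner (d k) (x (k - 1) - xs)))"
proof -
  let ?T = "\<lambda>k. (gap k / (2 * \<beta> k) * (norm (ag k - md k))\<^sup>2 + inner (d k) (ag k - md k)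
            + \<alpha> k * inner (d k) (x (k - 1) - xs)) / \<Gamma> k"
  let ?s = "\<lambda>k. noise_coeff k * (norm (d k))\<^sup>2 - \<alpha> k / \<Gamma> k * inner (d k) (x (k - 1) - xs)"
  have summand: "0 \<le> ?T k + ?s k" if k: "1 \<le> k" for k
  proof -
    from young_absorption[OF gap_pos[OF k] \<beta>_pos[OF k]]
    have "0 \<le> gap k / (2 * \<beta> k) * (norm (ag k - md k))\<^sup>2 + inner (d k) (ag k - md k)
        + \<beta> k * (4 + (gap k)\<^sup>2) / (4 * gap k) * (norm (d k))\<^sup>2" .
    from divide_right_mono[OF this less_imp_le[OF Gamma_pos[of k]]]
    have "0 \<le> (gap k / (2 * \<beta> k) * (norm (ag k - md k))\<^sup>2 + inner (d k) (ag k - md k)) / \<Gamma> k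
        + \<beta> k * (4 + (gap k)\<^sup>2) / (4 * gap k) * (norm (d k))\<^sup>2 / \<Gamma> k"
      by (simp add: add_divide_distrib)
    then show ?thesis
      by (simp add: noise_coeff_def add_divide_distrib ac_simps)
  qed
  have "0 \<le> (\<Sum>k=1..n. ?T k + ?s k)"
    by (intro sum_nonneg summand) auto
  then have 1: "0 \<le> (\<Sum>k=1..n. ?T k) + (\<Sum>k=1..n. ?s k)"
    by (simp only: sum.distrib)
  have "0 \<le> \<alpha> n"
    using \<alpha>1 \<alpha>_range[of n] n by (cases "n = 1") auto
  then have xn: "0 \<le> \<alpha> n / (lam n * \<Gamma> n) * (norm (x n - xs))\<^sup>2 / 2"
    using lam_pos[OF n] less_imp_le[OF Gamma_pos[of n]] by simp
  have "(obj (ag n) - obj xs) / \<Gamma> n + \<alpha> n / (lam n * \<Gamma> n) * (norm (x n - xs))\<^sup>2 / 2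
      + (\<Sum>k=1..n. ?T k) \<le> (norm (x0 - xs))\<^sup>2 / (2 * lam 1)"
    using rsag_energy[OF run n] Lf by (simp add: d_def)
  with 1 xn have "(obj (ag n) - obj xs) / \<Gamma> n \<le> (norm (x0 - xs))\<^sup>2 / (2 * lam 1) + (\<Sum>k=1..n. ?s k)"
    by linarith
  then show ?thesis
    by (simp only: pos_divide_le_eq[OF Gamma_pos] mult.commute)
qed

end

section \<open>Integrability of inner products and integral domination\<close>

lemma integrable_inner_of_square:
  fixes u v :: "'c \<Rightarrow> 'a::euclidean_space"
  assumes [measurable]: "u \<in> borel_measurable Q" "v \<in> borel_measurable Q"
    and "integrable Q (\<lambda>x. (norm (u x))\<^sup>2)" "integrable Q (\<lambda>x. (norm (v x))\<^sup>2)"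
  shows "integrable Q (\<lambda>x. inner (u x) (v x))"
proof (rule Bochner_Integration.integrable_bound)
  show "integrable Q (\<lambda>x. (norm (u x))\<^sup>2 + (norm (v x))\<^sup>2)" using assms by simp
  have "norm (inner (u x) (v x)) \<le> norm ((norm (u x))\<^sup>2 + (norm (v x))\<^sup>2)" for x
  proof -
    have "norm (inner (u x) (v x)) \<le> norm (u x) * norm (v x)"
      using Cauchy_Schwarz_ineq2 by simp
    also have "\<dots> \<le> 2 * norm (u x) * norm (v x)" by simp
    also have "\<dots> \<le> (norm (u x))\<^sup>2 + (norm (v x))\<^sup>2" by (rule sum_squares_bound)
    finally show ?thesis by simp
  qed
  then show "AE x in Q. norm (inner (u x) (v x)) \<le> norm ((norm (u x))\<^sup>2 + (norm (v x))\<^sup>2)" by simp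
qed measurable

text \<open>Passes from a pathwise bound to expectations. The bound \<open>v\<close> contains signed
  noise terms, but it is nonnegative because it dominates \<open>u\<close>.\<close>

lemma nn_integral_le_integral:
  fixes u v :: "'c \<Rightarrow> real"
  assumes "integrable Q v" "\<And>x. 0 \<le> u x" "\<And>x. u x \<le> v x"
  shows "(\<integral>\<^sup>+x. ennreal (u x) \<partial>Q) \<le> ennreal (\<integral>x. v x \<partial>Q)"
proof -
  have "(\<integral>\<^sup>+x. ennreal (u x) \<partial>Q) \<le> (\<integral>\<^sup>+x. ennreal (v x) \<partial>Q)"
    using assms by (intro nn_integral_mono ennreal_leI) auto
  also have "\<dots> = ennreal (\<integral>x. v x \<partial>Q)"
    using assms order_trans[of 0 "u _" "v _"]
    by (intro nn_integral_eq_integral AE_I2) auto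
  finally show ?thesis .
qed

section \<open>Expectations over the samples\<close>

locale rsag = rsag_parameters X f h gf gh Lf Lh M xs \<alpha> \<beta> lam
  for X :: "'a::euclidean_space \<Rightarrow> ereal" and f h gf gh Lf Lh M xs \<alpha> \<beta> lam +
  fixes \<sigma> :: real and G :: "'a \<Rightarrow> 'b \<Rightarrow> 'a" and S :: "'b measure"
    and D :: "nat \<Rightarrow> nat \<Rightarrow> 'b measure" and x0 :: 'a and m :: "nat \<Rightarrow> nat" and N :: nat
    and xit xag xmd Gbar :: "nat \<Rightarrow> (nat \<times> nat \<Rightarrow> 'b) \<Rightarrow> 'a"
  assumes D_prob: "\<And>k i. prob_space (D k i)"
    and D_sets: "\<And>k i. sets (D k i) = sets S"
    and G_meas: "(\<lambda>(x, \<xi>). G x \<xi>) \<in> borel_measurable (borel \<Otimes>\<^sub>M S)"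
    and G_integrable: "\<And>k i x. integrable (D k i) (G x)"
    and G_unbiased: "\<And>k i x. (\<integral>\<xi>. G x \<xi> \<partial>D k i) = grad x"
    and G_variance: "\<And>k i x. (\<integral>\<^sup>+\<xi>. ennreal ((norm (G x \<xi> - grad x))\<^sup>2) \<partial>D k i)
                               \<le> ennreal (\<sigma>\<^sup>2)"
    and m_pos: "\<And>k. k \<ge> 1 \<Longrightarrow> m k \<ge> 1"
    and N_pos: "N \<ge> 1"
    and it_x0: "\<And>\<omega>. xit 0 \<omega> = x0"
    and it_xag0: "\<And>\<omega>. xag 0 \<omega> = x0"
    and it_md: "\<And>k \<omega>. k \<ge> 1 \<Longrightarrow>
        xmd k \<omega> = (1 - \<alpha> k) *\<^sub>R xag (k - 1) \<omega> + \<alpha> k *\<^sub>R xit (k - 1) \<omega>"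
    and it_G: "\<And>k \<omega>. k \<ge> 1 \<Longrightarrow>
        Gbar k \<omega> = (1 / real (m k)) *\<^sub>R (\<Sum>i=1..m k. G (xmd k \<omega>) (\<omega> (k, i)))"
    and it_x: "\<And>k \<omega>. k \<ge> 1 \<Longrightarrow> xit k \<omega> = prox_map X (xit (k - 1) \<omega>) (Gbar k \<omega>) (lam k)"
    and it_xag: "\<And>k \<omega>. k \<ge> 1 \<Longrightarrow> xag k \<omega> = prox_map X (xmd k \<omega>) (Gbar k \<omega>) (\<beta> k)"
begin

text \<open>All \<open>N\<close> batches are drawn. An iterate uses only samples up to its own
  iteration, so stopping at the random index amounts to selecting which iterate is
  evaluated.\<close>

definition calls :: "(nat \<times> nat) set" where
  "calls = Sigma {1..N} (\<lambda>k. {1..m k})"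

abbreviation Dc :: "nat \<times> nat \<Rightarrow> 'b measure" where
  "Dc \<equiv> \<lambda>c. D (fst c) (snd c)"

abbreviation \<Xi> :: "(nat \<times> nat \<Rightarrow> 'b) measure" where
  "\<Xi> \<equiv> Pi\<^sub>M calls Dc"

lemma finite_calls [simp]: "finite calls"
  by (simp add: calls_def)

lemma mem_calls: "(k, i) \<in> calls \<longleftrightarrow> 1 \<le> k \<and> k \<le> N \<and> 1 \<le> i \<and> i \<le> m k"
  by (auto simp: calls_def)

sublocale samples: product_sigma_finite Dc
  using prob_space_imp_sigma_finite[OF D_prob] by (simp add: product_sigma_finite_def)

sublocale \<Xi>: prob_space \<Xi>
  by (rule prob_space_PiM[OF D_prob])

lemma run: "rsag_run x0 (\<lambda>k. xit k \<omega>) (\<lambda>k. xag k \<omega>) (\<lambda>k. xmd k \<omega>) (\<lambda>k. Gbar k \<omega>)"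
  unfolding rsag_run_def using it_x0 it_xag0 it_md it_x it_xag by blast

lemma sample_measurable:
  assumes "z \<in> borel_measurable \<Xi>" "(k, i) \<in> calls"
  shows "(\<lambda>\<omega>. G (z \<omega>) (\<omega> (k, i))) \<in> borel_measurable \<Xi>"
proof -
  have "(\<lambda>\<omega>. \<omega> (k, i)) \<in> \<Xi> \<rightarrow>\<^sub>M Dc (k, i)"
    using assms by (intro measurable_component_singleton)
  then have "(\<lambda>\<omega>. \<omega> (k, i)) \<in> \<Xi> \<rightarrow>\<^sub>M S"
    using measurable_cong_sets[OF refl D_sets] by auto
  then have "(\<lambda>\<omega>. (z \<omega>, \<omega> (k, i))) \<in> \<Xi> \<rightarrow>\<^sub>M borel \<Otimes>\<^sub>M S"
    using assms by (intro measurable_Pair)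
  from measurable_compose[OF this G_meas] show ?thesis by simp
qed

lemma Gbar_measurable:
  assumes "1 \<le> k" "k \<le> N" "xmd k \<in> borel_measurable \<Xi>"
  shows "Gbar k \<in> borel_measurable \<Xi>"
proof -
  have "Gbar k = (\<lambda>\<omega>. (1 / real (m k)) *\<^sub>R (\<Sum>i=1..m k. G (xmd k \<omega>) (\<omega> (k, i))))"
    using it_G assms by auto
  moreover have "\<dots> \<in> borel_measurable \<Xi>"
    using assms
    by (intro borel_measurable_scaleR borel_measurable_const borel_measurable_sum sample_measurable)
      (auto simp: mem_calls)
  ultimately show ?thesis by simp
qed

lemma xmd_measurable_step:
  assumes "1 \<le> k" "xit (k - 1) \<in> borel_measurable \<Xi>" "xag (k - 1) \<in> borel_measurable \<Xi>"
  shows "xmd k \<in> borel_measurable \<Xi>"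
proof -
  have "xmd k = (\<lambda>\<omega>. (1 - \<alpha> k) *\<^sub>R xag (k - 1) \<omega> + \<alpha> k *\<^sub>R xit (k - 1) \<omega>)"
    using it_md assms by auto
  moreover have "\<dots> \<in> borel_measurable \<Xi>"
    by (intro borel_measurable_add borel_measurable_scaleR borel_measurable_const assms)
  ultimately show ?thesis by simp
qed

text \<open>Restricted to \<open>k \<le> N\<close>, since later iterates read coordinates outside
  \<open>calls\<close>.\<close>

lemma iterates_measurable:
  "k \<le> N \<Longrightarrow> xit k \<in> borel_measurable \<Xi> \<and> xag k \<in> borel_measurable \<Xi>"
proof (induction k)
  case 0
  have "xit 0 = (\<lambda>_. x0)" "xag 0 = (\<lambda>_. x0)" using it_x0 it_xag0 by auto
  then show ?case by simp
next
  case (Suc k)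
  then have prev: "xit k \<in> borel_measurable \<Xi>" "xag k \<in> borel_measurable \<Xi>" by auto
  then have md: "xmd (Suc k) \<in> borel_measurable \<Xi>"
    using xmd_measurable_step[of "Suc k"] by simp
  then have G: "Gbar (Suc k) \<in> borel_measurable \<Xi>"
    using Suc.prems by (intro Gbar_measurable) auto
  have "xit (Suc k) = (\<lambda>\<omega>. prox_map X (xit k \<omega>) (Gbar (Suc k) \<omega>) (lam (Suc k)))"
    "xag (Suc k) = (\<lambda>\<omega>. prox_map X (xmd (Suc k) \<omega>) (Gbar (Suc k) \<omega>) (\<beta> (Suc k)))"
    using it_x[of "Suc k"] it_xag[of "Suc k"] by auto
  then show ?case
    using measurable_prox_map[OF lam_pos prev(1) G] measurable_prox_map[OF \<beta>_pos md G] by simp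
qed

lemma xmd_measurable: "1 \<le> k \<Longrightarrow> k \<le> N \<Longrightarrow> xmd k \<in> borel_measurable \<Xi>"
  using iterates_measurable[of "k - 1"] by (intro xmd_measurable_step) auto

text \<open>Adaptedness in functional form: it replaces a filtration. Its consequence is that
  changing a sample of iteration \<open>k\<close> leaves \<open>xit (k - 1)\<close> and
  \<open>xmd k\<close> unchanged.\<close>

lemma iterates_cong:
  assumes "\<And>j i. j \<le> k \<Longrightarrow> \<omega> (j, i) = \<omega>' (j, i)"
  shows "xit k \<omega> = xit k \<omega>' \<and> xag k \<omega> = xag k \<omega>'"
  using assms
proof (induction k)
  case 0
  then show ?case by (simp add: it_x0 it_xag0)
next
  case (Suc k)
  then have "xit k \<omega> = xit k \<omega>'" "xag k \<omega> = xag k \<omega>'" by auto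
  moreover from this have "xmd (Suc k) \<omega> = xmd (Suc k) \<omega>'"
    by (simp add: it_md)
  moreover from this have "Gbar (Suc k) \<omega> = Gbar (Suc k) \<omega>'"
    using Suc.prems by (simp add: it_G)
  ultimately show ?case by (simp add: it_x it_xag)
qed

lemma xit_upd: "1 \<le> k \<Longrightarrow> xit (k - 1) (fun_upd \<omega> (k, i) \<xi>) = xit (k - 1) \<omega>"
  by (rule iterates_cong[THEN conjunct1]) auto

lemma xmd_upd: "1 \<le> k \<Longrightarrow> xmd k (fun_upd \<omega> (k, i) \<xi>) = xmd k \<omega>"
  using iterates_cong[of "k - 1" "fun_upd \<omega> (k, i) \<xi>" \<omega>] by (force simp: it_md)

section \<open>Mean and variance of the gradient errors\<close>

definition err :: "nat \<Rightarrow> nat \<Rightarrow> (nat \<times> nat \<Rightarrow> 'b) \<Rightarrow> 'a" where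
  "err k i \<omega> = G (xmd k \<omega>) (\<omega> (k, i)) - grad (xmd k \<omega>)"

lemma grad_xmd_measurable: "1 \<le> k \<Longrightarrow> k \<le> N \<Longrightarrow> (\<lambda>\<omega>. grad (xmd k \<omega>)) \<in> borel_measurable \<Xi>"
  by (rule measurable_compose[OF xmd_measurable borel_measurable_continuous_onI[OF continuous_grad]])

lemma err_measurable: "(k, i) \<in> calls \<Longrightarrow> err k i \<in> borel_measurable \<Xi>"
  unfolding err_def[abs_def]
  by (intro borel_measurable_diff sample_measurable grad_xmd_measurable xmd_measurable)
    (auto simp: mem_calls)

text \<open>Fubini integrates the sample \<open>(k, i)\<close> first. With the other samples fixed,
  \<open>xmd k\<close> and \<open>v\<close> are constant, and the inner integral vanishes by
  unbiasedness. This takes the place of conditional expectations.\<close>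

lemma err_orthogonal:
  assumes c: "(k, i) \<in> calls" and v: "\<And>\<omega> \<xi>. v (fun_upd \<omega> (k, i) \<xi>) = v \<omega>"
    and int: "integrable \<Xi> (\<lambda>\<omega>. inner (err k i \<omega>) (v \<omega>))"
  shows "(\<integral>\<omega>. inner (err k i \<omega>) (v \<omega>) \<partial>\<Xi>) = 0"
proof -
  interpret Dki: prob_space "D k i" by (rule D_prob)
  let ?J = "calls - {(k, i)}"
  have k: "1 \<le> k" using c by (simp add: mem_calls)
  have "(\<integral>\<omega>. inner (err k i \<omega>) (v \<omega>) \<partial>Pi\<^sub>M (insert (k, i) ?J) Dc)
    = (\<integral>\<omega>. (\<integral>\<xi>. inner (err k i (fun_upd \<omega> (k, i) \<xi>)) (v (fun_upd \<omega> (k, i) \<xi>)) \<partial>Dc (k, i)) \<partial>Pi\<^sub>M ?J Dc)"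
    using int by (intro samples.product_integral_insert) (auto simp: insert_absorb[OF c])
  also have "\<dots> = (\<integral>\<omega>. 0 \<partial>Pi\<^sub>M ?J Dc)"
  proof (rule Bochner_Integration.integral_cong[OF refl])
    fix \<omega>
    have "(\<integral>\<xi>. inner (G (xmd k \<omega>) \<xi> - grad (xmd k \<omega>)) (v \<omega>) \<partial>D k i)
      = inner (\<integral>\<xi>. G (xmd k \<omega>) \<xi> - grad (xmd k \<omega>) \<partial>D k i) (v \<omega>)"
      using G_integrable by (intro integral_inner_left) auto
    also have "\<dots> = 0" using G_integrable by (simp add: G_unbiased Dki.prob_space)
    finally show "(\<integral>\<xi>. inner (err k i (fun_upd \<omega> (k, i) \<xi>)) (v (fun_upd \<omega> (k, i) \<xi>)) \<partial>Dc (k, i)) = 0"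
      using k by (simp add: err_def xmd_upd v)
  qed
  finally show ?thesis by (simp add: insert_absorb[OF c])
qed

text \<open>The same integration order with nonnegative integrals, which needs no integrability in
  advance; the finite result then supplies it.\<close>

lemma err_variance:
  assumes c: "(k, i) \<in> calls"
  shows "integrable \<Xi> (\<lambda>\<omega>. (norm (err k i \<omega>))\<^sup>2)" "(\<integral>\<omega>. (norm (err k i \<omega>))\<^sup>2 \<partial>\<Xi>) \<le> \<sigma>\<^sup>2"
proof -
  let ?J = "calls - {(k, i)}"
  have k: "1 \<le> k" using c by (simp add: mem_calls)
  note [measurable] = err_measurable[OF c]
  have meas: "(\<lambda>\<omega>. (norm (err k i \<omega>))\<^sup>2) \<in> borel_measurable \<Xi>" by measurable
  interpret J: prob_space "Pi\<^sub>M ?J Dc" by (rule prob_space_PiM[OF D_prob])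
  have "(\<integral>\<^sup>+\<omega>. ennreal ((norm (err k i \<omega>))\<^sup>2) \<partial>Pi\<^sub>M (insert (k, i) ?J) Dc)
    = (\<integral>\<^sup>+\<omega>. (\<integral>\<^sup>+\<xi>. ennreal ((norm (err k i (fun_upd \<omega> (k, i) \<xi>)))\<^sup>2) \<partial>Dc (k, i)) \<partial>Pi\<^sub>M ?J Dc)"
    using meas by (intro samples.product_nn_integral_insert) (auto simp: insert_absorb[OF c])
  also have "\<dots> \<le> (\<integral>\<^sup>+\<omega>. ennreal (\<sigma>\<^sup>2) \<partial>Pi\<^sub>M ?J Dc)"
    using G_variance k by (intro nn_integral_mono) (simp add: err_def xmd_upd)
  also have "\<dots> = ennreal (\<sigma>\<^sup>2)" by (simp add: J.emeasure_space_1)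
  finally have le: "(\<integral>\<^sup>+\<omega>. ennreal ((norm (err k i \<omega>))\<^sup>2) \<partial>\<Xi>) \<le> ennreal (\<sigma>\<^sup>2)"
    by (simp add: insert_absorb[OF c])
  show int: "integrable \<Xi> (\<lambda>\<omega>. (norm (err k i \<omega>))\<^sup>2)"
    using meas le by (intro integrableI_bounded) (auto intro: order.strict_trans1)
  show "(\<integral>\<omega>. (norm (err k i \<omega>))\<^sup>2 \<partial>\<Xi>) \<le> \<sigma>\<^sup>2"
    using le by (subst (asm) nn_integral_eq_integral[OF int]) auto
qed

lemma err_inner_integrable:
  "(k, i) \<in> calls \<Longrightarrow> (k, j) \<in> calls \<Longrightarrow> integrable \<Xi> (\<lambda>\<omega>. inner (err k i \<omega>) (err k j \<omega>))"
  by (intro integrable_inner_of_square err_measurable err_variance(1))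

definition batch_err :: "nat \<Rightarrow> (nat \<times> nat \<Rightarrow> 'b) \<Rightarrow> 'a" where
  "batch_err k \<omega> = Gbar k \<omega> - grad (xmd k \<omega>)"

lemma batch_err_eq:
  assumes "1 \<le> k"
  shows "batch_err k \<omega> = (1 / real (m k)) *\<^sub>R (\<Sum>i=1..m k. err k i \<omega>)"
  using m_pos[OF assms] assms
  by (simp add: batch_err_def err_def it_G sum_subtractf scaleR_diff_right sum_constant_scaleR)

text \<open>The squared norm of the average expands into a double sum over the batch. The mixed
  terms have mean zero, and the \<open>m k\<close> diagonal ones contribute at most
  \<open>\<sigma>\<^sup>2\<close> each, against the factor
  \<open>1 / (real (m k))\<^sup>2\<close>.\<close>

lemma batch_err_variance:
  assumes k: "1 \<le> k" "k \<le> N"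
  shows "integrable \<Xi> (\<lambda>\<omega>. (norm (batch_err k \<omega>))\<^sup>2)"
    "(\<integral>\<omega>. (norm (batch_err k \<omega>))\<^sup>2 \<partial>\<Xi>) \<le> \<sigma>\<^sup>2 / real (m k)"
proof -
  have mem: "(k, i) \<in> calls" if "i \<in> {1..m k}" for i using that k by (simp add: mem_calls)
  have eq: "(norm (batch_err k \<omega>))\<^sup>2
      = 1 / (real (m k))\<^sup>2 * (\<Sum>i=1..m k. \<Sum>j=1..m k. inner (err k i \<omega>) (err k j \<omega>))" for \<omega>
    unfolding power2_norm_eq_inner batch_err_eq[OF k(1)]
    by (simp add: inner_sum_left inner_sum_right power2_eq_square sum_divide_distrib inner_commute)
  have int: "integrable \<Xi> (\<lambda>\<omega>. inner (err k i \<omega>) (err k j \<omega>))"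
    if "i \<in> {1..m k}" "j \<in> {1..m k}" for i j
    using that mem by (intro err_inner_integrable) auto
  show "integrable \<Xi> (\<lambda>\<omega>. (norm (batch_err k \<omega>))\<^sup>2)"
    unfolding eq using int by (intro integrable_mult_right Bochner_Integration.integrable_sum) auto
  have ij: "(\<integral>\<omega>. inner (err k i \<omega>) (err k j \<omega>) \<partial>\<Xi>) \<le> (if i = j then \<sigma>\<^sup>2 else 0)"
    if i: "i \<in> {1..m k}" and j: "j \<in> {1..m k}" for i j
  proof (cases "i = j")
    case True
    then show ?thesis using err_variance(2)[OF mem[OF i]] by (simp add: power2_norm_eq_inner)
  next
    case False
    \<comment> \<open>\<open>err k j\<close> depends on batch \<open>k\<close> only through the
      sample \<open>(k, j)\<close>, so it may serve as the test vector \<open>v\<close> for the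
      sample \<open>(k, i)\<close>.\<close>
    then have "err k j (fun_upd \<omega> (k, i) \<xi>) = err k j \<omega>" for \<omega> \<xi>
      using k by (simp add: err_def xmd_upd)
    from err_orthogonal[OF mem[OF i] this int[OF i j]] False show ?thesis by simp
  qed
  have "(\<integral>\<omega>. (norm (batch_err k \<omega>))\<^sup>2 \<partial>\<Xi>)
      = 1 / (real (m k))\<^sup>2 * (\<Sum>i=1..m k. \<Sum>j=1..m k. \<integral>\<omega>. inner (err k i \<omega>) (err k j \<omega>) \<partial>\<Xi>)"
  proof -
    have "(\<integral>\<omega>. (\<Sum>i=1..m k. \<Sum>j=1..m k. inner (err k i \<omega>) (err k j \<omega>)) \<partial>\<Xi>)
      = (\<Sum>i=1..m k. \<integral>\<omega>. (\<Sum>j=1..m k. inner (err k i \<omega>) (err k j \<omega>)) \<partial>\<Xi>)"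
      by (intro Bochner_Integration.integral_sum Bochner_Integration.integrable_sum int)
    also have "\<dots> = (\<Sum>i=1..m k. \<Sum>j=1..m k. \<integral>\<omega>. inner (err k i \<omega>) (err k j \<omega>) \<partial>\<Xi>)"
      by (intro sum.cong refl Bochner_Integration.integral_sum int)
    finally show ?thesis unfolding eq by simp
  qed
  also have "\<dots> \<le> 1 / (real (m k))\<^sup>2 * (\<Sum>i=1..m k. \<Sum>j=1..m k. if i = j then \<sigma>\<^sup>2 else 0)"
    using ij by (intro mult_left_mono sum_mono) auto
  also have "\<dots> = 1 / (real (m k))\<^sup>2 * (real (m k) * \<sigma>\<^sup>2)"
    by simp
  also have "\<dots> = \<sigma>\<^sup>2 / real (m k)"
    using m_pos[OF k(1)] by (simp add: power2_eq_square)
  finally show "(\<integral>\<omega>. (norm (batch_err k \<omega>))\<^sup>2 \<partial>\<Xi>) \<le> \<sigma>\<^sup>2 / real (m k)" .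
qed

text \<open>The maximum accounts for \<open>k = 0\<close>, where the iterate is \<open>x0\<close>
  and not a prox value.\<close>

lemma xit_bounded: "norm (xit k \<omega>) \<le> max M (norm x0)"
  using M_bound[OF lam_pos] by (cases k) (auto simp: it_x0 it_x le_max_iff_disj)

text \<open>The previous iterate is bounded, which gives integrability, and it does not see batch
  \<open>k\<close>, so each sample of the batch is orthogonal to it.\<close>

lemma batch_err_martingale:
  assumes k: "1 \<le> k" "k \<le> N"
  shows "integrable \<Xi> (\<lambda>\<omega>. inner (batch_err k \<omega>) (xit (k - 1) \<omega> - xs))"
    "(\<integral>\<omega>. inner (batch_err k \<omega>) (xit (k - 1) \<omega> - xs) \<partial>\<Xi>) = 0"
proof -
  have mem: "(k, i) \<in> calls" if "i \<in> {1..m k}" for i using that k by (simp add: mem_calls)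
  have eq: "inner (batch_err k \<omega>) (xit (k - 1) \<omega> - xs)
      = 1 / real (m k) * (\<Sum>i=1..m k. inner (err k i \<omega>) (xit (k - 1) \<omega> - xs))" for \<omega>
    unfolding batch_err_eq[OF k(1)] by (simp add: inner_sum_left)
  have meas: "(\<lambda>\<omega>. xit (k - 1) \<omega> - xs) \<in> borel_measurable \<Xi>"
    using iterates_measurable[of "k - 1"] k by (intro borel_measurable_diff) auto
  have "integrable \<Xi> (\<lambda>\<omega>. (norm (xit (k - 1) \<omega> - xs))\<^sup>2)"
  proof (rule \<Xi>.integrable_const_bound)
    show "AE \<omega> in \<Xi>. norm ((norm (xit (k - 1) \<omega> - xs))\<^sup>2) \<le> (max M (norm x0) + norm xs)\<^sup>2"
    proof (rule AE_I2)
      fix \<omega>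
      have "norm (xit (k - 1) \<omega> - xs) \<le> max M (norm x0) + norm xs"
        using norm_triangle_ineq4[of "xit (k - 1) \<omega>" xs] xit_bounded[of "k - 1" \<omega>] by linarith
      then show "norm ((norm (xit (k - 1) \<omega> - xs))\<^sup>2) \<le> (max M (norm x0) + norm xs)\<^sup>2"
        by (simp add: power_mono)
    qed
    show "(\<lambda>\<omega>. (norm (xit (k - 1) \<omega> - xs))\<^sup>2) \<in> borel_measurable \<Xi>"
      using meas by measurable
  qed
  then have int: "integrable \<Xi> (\<lambda>\<omega>. inner (err k i \<omega>) (xit (k - 1) \<omega> - xs))"
    if "i \<in> {1..m k}" for i
    using mem[OF that] meas by (intro integrable_inner_of_square err_measurable err_variance(1))
  then show "integrable \<Xi> (\<lambda>\<omega>. inner (batch_err k \<omega>) (xit (k - 1) \<omega> - xs))"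
    unfolding eq by (intro integrable_mult_right Bochner_Integration.integrable_sum) auto
  have "(\<integral>\<omega>. inner (err k i \<omega>) (xit (k - 1) \<omega> - xs) \<partial>\<Xi>) = 0" if "i \<in> {1..m k}" for i
    using mem[OF that] int[OF that] xit_upd[OF k(1)] by (intro err_orthogonal) simp_all
  then show "(\<integral>\<omega>. inner (batch_err k \<omega>) (xit (k - 1) \<omega> - xs) \<partial>\<Xi>) = 0"
    unfolding eq using int by (simp add: Bochner_Integration.integral_sum)
qed

text \<open>Serves both bounds: with \<open>2 * noise_coeff\<close> up to \<open>N\<close> for the
  gradient mapping, and with \<open>noise_coeff\<close> up to each \<open>k\<close> for the
  objective gap. The sign of \<open>b\<close> is free because its terms have mean zero.\<close>

lemma noise_sum:
  fixes a b :: "nat \<Rightarrow> real"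
  assumes n: "n \<le> N" and a: "\<And>k. 1 \<le> k \<Longrightarrow> 0 \<le> a k"
  defines "s \<equiv> \<lambda>\<omega>. \<Sum>k=1..n. a k * (norm (batch_err k \<omega>))\<^sup>2
      - b k * inner (batch_err k \<omega>) (xit (k - 1) \<omega> - xs)"
  shows "integrable \<Xi> s" "(\<integral>\<omega>. s \<omega> \<partial>\<Xi>) \<le> \<sigma>\<^sup>2 * (\<Sum>k=1..n. a k / real (m k))"
proof -
  have k: "1 \<le> k" "k \<le> N" if "k \<in> {1..n}" for k using that n by auto
  have int: "integrable \<Xi> (\<lambda>\<omega>. a k * (norm (batch_err k \<omega>))\<^sup>2)"
    "integrable \<Xi> (\<lambda>\<omega>. b k * inner (batch_err k \<omega>) (xit (k - 1) \<omega> - xs))" if "k \<in> {1..n}" for k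
    using batch_err_variance(1)[OF k[OF that]] batch_err_martingale(1)[OF k[OF that]]
    by (auto intro: integrable_mult_right)
  show "integrable \<Xi> s"
    unfolding s_def by (intro Bochner_Integration.integrable_sum Bochner_Integration.integrable_diff int)
  have "(\<integral>\<omega>. s \<omega> \<partial>\<Xi>) = (\<Sum>k=1..n. \<integral>\<omega>. a k * (norm (batch_err k \<omega>))\<^sup>2
      - b k * inner (batch_err k \<omega>) (xit (k - 1) \<omega> - xs) \<partial>\<Xi>)"
    unfolding s_def
    by (intro Bochner_Integration.integral_sum Bochner_Integration.integrable_diff int)
  also have "\<dots> \<le> (\<Sum>k=1..n. a k * (\<sigma>\<^sup>2 / real (m k)))"
  proof (rule sum_mono)
    fix k assume kn: "k \<in> {1..n}"
    have "(\<integral>\<omega>. a k * (norm (batch_err k \<omega>))\<^sup>2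
        - b k * inner (batch_err k \<omega>) (xit (k - 1) \<omega> - xs) \<partial>\<Xi>)
      = a k * (\<integral>\<omega>. (norm (batch_err k \<omega>))\<^sup>2 \<partial>\<Xi>)"
      using int[OF kn] batch_err_martingale(2)[OF k[OF kn]] by simp
    also have "\<dots> \<le> a k * (\<sigma>\<^sup>2 / real (m k))"
      using a k[OF kn] batch_err_variance(2)[OF k[OF kn]] by (intro mult_left_mono) auto
    finally show "(\<integral>\<omega>. a k * (norm (batch_err k \<omega>))\<^sup>2
        - b k * inner (batch_err k \<omega>) (xit (k - 1) \<omega> - xs) \<partial>\<Xi>) \<le> a k * (\<sigma>\<^sup>2 / real (m k))" .
  qed
  also have "\<dots> = \<sigma>\<^sup>2 * (\<Sum>k=1..n. a k / real (m k))"
    by (simp add: sum_distrib_left ac_simps)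
  finally show "(\<integral>\<omega>. s \<omega> \<partial>\<Xi>) \<le> \<sigma>\<^sup>2 * (\<Sum>k=1..n. a k / real (m k))" .
qed

end

section \<open>The random index and the two expected bounds\<close>

context rsag
begin

definition weight :: "nat \<Rightarrow> real" where
  "weight k = \<beta> k * gap k / \<Gamma> k"

definition total_weight :: real where
  "total_weight = (\<Sum>k=1..N. weight k)"

abbreviation index_measure :: "nat measure" where
  "index_measure \<equiv> point_measure {1..N} (\<lambda>k. ennreal (weight k / total_weight))"

lemma weight_pos: "1 \<le> k \<Longrightarrow> 0 < weight k"
  using \<beta>_pos gap_pos Gamma_pos by (simp add: weight_def)

lemma total_weight_pos: "0 < total_weight"
  unfolding total_weight_def using N_pos by (intro sum_pos) (auto simp: weight_pos)

text \<open>The index takes finitely many values, so joint measurability reduces to that of each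
  \<open>F k\<close>, and the product integral is a weighted sum.\<close>

lemma nn_integral_random_index:
  assumes F: "\<And>k. k \<in> {1..N} \<Longrightarrow> F k \<in> borel_measurable \<Xi>"
  shows "(\<integral>\<^sup>+(k, \<omega>). F k \<omega> \<partial>(index_measure \<Otimes>\<^sub>M \<Xi>))
    = (\<Sum>k=1..N. ennreal (weight k / total_weight) * (\<integral>\<^sup>+\<omega>. F k \<omega> \<partial>\<Xi>))"
proof -
  have "(\<lambda>(k, \<omega>). F k \<omega>) \<in> borel_measurable (count_space {1..N} \<Otimes>\<^sub>M \<Xi>)"
    using F by (intro measurable_pair_measure_countable1) auto
  then have "(\<lambda>(k, \<omega>). F k \<omega>) \<in> borel_measurable (index_measure \<Otimes>\<^sub>M \<Xi>)"
    by (subst measurable_cong_sets[OF sets_pair_measure_cong[OF _ refl] refl, of _ "count_space {1..N}"])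
      (simp_all add: sets_point_measure)
  from \<Xi>.nn_integral_fst[OF this, symmetric] show ?thesis
    by (simp add: nn_integral_point_measure_finite)
qed

lemma grad_map_measurable:
  assumes "k \<in> {1..N}"
  shows "(\<lambda>\<omega>. grad_map X (xmd k \<omega>) (grad (xmd k \<omega>)) (\<beta> k)) \<in> borel_measurable \<Xi>"
  using assms unfolding grad_map_def
  by (intro borel_measurable_scaleR borel_measurable_const borel_measurable_diff
      measurable_prox_map \<beta>_pos xmd_measurable grad_xmd_measurable) auto

lemma val_measurable: "val \<in> borel_measurable borel"
  unfolding val_def[abs_def] by (rule measurable_compose[OF borel_measurable_X]) simp

lemma obj_xag_measurable: "k \<le> N \<Longrightarrow> (\<lambda>\<omega>. obj (xag k \<omega>)) \<in> borel_measurable \<Xi>"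
proof -
  assume k: "k \<le> N"
  have "obj \<in> borel_measurable borel"
    unfolding obj_def[abs_def]
    by (intro borel_measurable_add val_measurable borel_measurable_continuous_onI continuous_smooth)
  from measurable_compose[OF _ this] iterates_measurable[OF k] show ?thesis by blast
qed

text \<open>The index probabilities are proportional to the weights in
  \<open>grad_map_sum_le\<close>. Moving the sum over \<open>k\<close> inside the expectation makes
  that bound applicable for every sample.\<close>

lemma expected_grad_map_le:
  "(\<integral>\<^sup>+(k, \<omega>). ennreal ((norm (grad_map X (xmd k \<omega>) (grad (xmd k \<omega>)) (\<beta> k)))\<^sup>2)
      \<partial>(index_measure \<Otimes>\<^sub>M \<Xi>))
    \<le> ennreal (8 / total_weight *
        ((norm (x0 - xs))\<^sup>2 / (2 * lam 1) + Lf / \<Gamma> N * ((norm xs)\<^sup>2 + 2 * M\<^sup>2)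
          + \<sigma>\<^sup>2 * (\<Sum>k=1..N. noise_coeff k / real (m k))))"
proof -
  let ?W = total_weight
  let ?g = "\<lambda>k \<omega>. (norm (grad_map X (xmd k \<omega>) (grad (xmd k \<omega>)) (\<beta> k)))\<^sup>2"
  define C where "C = (norm (x0 - xs))\<^sup>2 / lam 1 + Lf * (1 / \<Gamma> N - 1) * ((norm xs)\<^sup>2 + M\<^sup>2)"
  define s where "s = (\<lambda>\<omega>. \<Sum>k=1..N. 2 * noise_coeff k * (norm (batch_err k \<omega>))\<^sup>2
      - \<alpha> k / \<Gamma> k * inner (batch_err k \<omega>) (xit (k - 1) \<omega> - xs))"
  have s: "integrable \<Xi> s" "(\<integral>\<omega>. s \<omega> \<partial>\<Xi>) \<le> \<sigma>\<^sup>2 * (\<Sum>k=1..N. 2 * noise_coeff k / real (m k))"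
    unfolding s_def using noise_coeff_nonneg by (intro noise_sum; simp)+
  have meas: "(\<lambda>\<omega>. ennreal (?g k \<omega>)) \<in> borel_measurable \<Xi>" if "k \<in> {1..N}" for k
    using grad_map_measurable[OF that] by simp
  have w: "0 \<le> weight k / ?W" if "k \<in> {1..N}" for k
    using weight_pos[of k] total_weight_pos that by simp
  have "(\<integral>\<^sup>+(k, \<omega>). ennreal (?g k \<omega>) \<partial>(index_measure \<Otimes>\<^sub>M \<Xi>))
      = (\<Sum>k=1..N. ennreal (weight k / ?W) * (\<integral>\<^sup>+\<omega>. ennreal (?g k \<omega>) \<partial>\<Xi>))"
    by (rule nn_integral_random_index[OF meas])
  also have "\<dots> = (\<Sum>k=1..N. \<integral>\<^sup>+\<omega>. ennreal (weight k / ?W) * ennreal (?g k \<omega>) \<partial>\<Xi>)"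
    using meas by (intro sum.cong refl nn_integral_cmult[symmetric])
  also have "\<dots> = (\<integral>\<^sup>+\<omega>. (\<Sum>k=1..N. ennreal (weight k / ?W) * ennreal (?g k \<omega>)) \<partial>\<Xi>)"
    using meas by (intro nn_integral_sum[symmetric] borel_measurable_times_ennreal) auto
  also have "\<dots> = (\<integral>\<^sup>+\<omega>. ennreal ((\<Sum>k=1..N. weight k * ?g k \<omega>) / ?W) \<partial>\<Xi>)"
  proof (rule nn_integral_cong)
    fix \<omega>
    have "(\<Sum>k=1..N. ennreal (weight k / ?W) * ennreal (?g k \<omega>))
        = (\<Sum>k=1..N. ennreal (weight k / ?W * ?g k \<omega>))"
      using w by (intro sum.cong refl ennreal_mult[symmetric]) auto
    also have "\<dots> = ennreal (\<Sum>k=1..N. weight k / ?W * ?g k \<omega>)"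
      using w by (intro sum_ennreal mult_nonneg_nonneg) auto
    finally show "(\<Sum>k=1..N. ennreal (weight k / ?W) * ennreal (?g k \<omega>))
        = ennreal ((\<Sum>k=1..N. weight k * ?g k \<omega>) / ?W)"
      by (simp add: sum_divide_distrib)
  qed
  also have "\<dots> \<le> ennreal (\<integral>\<omega>. 4 / ?W * (C + s \<omega>) \<partial>\<Xi>)"
  proof (rule nn_integral_le_integral)
    show "integrable \<Xi> (\<lambda>\<omega>. 4 / ?W * (C + s \<omega>))" using s(1) by simp
    show "0 \<le> (\<Sum>k=1..N. weight k * ?g k \<omega>) / ?W" for \<omega>
      using weight_pos total_weight_pos
      by (intro divide_nonneg_nonneg sum_nonneg mult_nonneg_nonneg) (auto simp: less_imp_le)
    show "(\<Sum>k=1..N. weight k * ?g k \<omega>) / ?W \<le> 4 / ?W * (C + s \<omega>)" for \<omega>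
      using divide_right_mono[OF grad_map_sum_le[OF run N_pos, of \<omega>], of ?W] total_weight_pos
      by (simp add: weight_def C_def s_def batch_err_def)
  qed
  also have "(\<integral>\<omega>. 4 / ?W * (C + s \<omega>) \<partial>\<Xi>) = 4 / ?W * (C + (\<integral>\<omega>. s \<omega> \<partial>\<Xi>))"
    using s(1) by (simp add: \<Xi>.prob_space)
  also have "ennreal \<dots> \<le> ennreal (8 / ?W *
        ((norm (x0 - xs))\<^sup>2 / (2 * lam 1) + Lf / \<Gamma> N * ((norm xs)\<^sup>2 + 2 * M\<^sup>2)
          + \<sigma>\<^sup>2 * (\<Sum>k=1..N. noise_coeff k / real (m k))))"
  proof (rule ennreal_leI)
    \<comment> \<open>Half of the final constant 8 is already present as 4; the other factor 2 is
      drawn from the distance and noise terms exactly, and from the curvature term by this crude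
      estimate.\<close>
    have "Lf * (1 / \<Gamma> N - 1) * ((norm xs)\<^sup>2 + M\<^sup>2) \<le> Lf * (1 / \<Gamma> N) * (2 * ((norm xs)\<^sup>2 + 2 * M\<^sup>2))"
      using Lf_nonneg less_imp_le[OF Gamma_pos[of N]]
      by (intro mult_mono[OF mult_left_mono]) auto
    moreover have "(\<integral>\<omega>. s \<omega> \<partial>\<Xi>) \<le> 2 * (\<sigma>\<^sup>2 * (\<Sum>k=1..N. noise_coeff k / real (m k)))"
      using s(2) by (simp add: sum_distrib_left ac_simps)
    ultimately have "C + (\<integral>\<omega>. s \<omega> \<partial>\<Xi>) \<le> 2 * ((norm (x0 - xs))\<^sup>2 / (2 * lam 1)
        + Lf / \<Gamma> N * ((norm xs)\<^sup>2 + 2 * M\<^sup>2) + \<sigma>\<^sup>2 * (\<Sum>k=1..N. noise_coeff k / real (m k)))"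
      unfolding C_def by (simp add: algebra_simps)
    from mult_left_mono[OF this, of "4 / ?W"]
    show "4 / ?W * (C + (\<integral>\<omega>. s \<omega> \<partial>\<Xi>)) \<le> 8 / ?W * ((norm (x0 - xs))\<^sup>2 / (2 * lam 1)
        + Lf / \<Gamma> N * ((norm xs)\<^sup>2 + 2 * M\<^sup>2) + \<sigma>\<^sup>2 * (\<Sum>k=1..N. noise_coeff k / real (m k)))"
      using total_weight_pos by simp
  qed
  finally show ?thesis .
qed

text \<open>In contrast to the gradient mapping, each index is bounded separately by
  \<open>obj_gap_le\<close>, and the bounds are averaged over the index.\<close>

lemma expected_obj_gap_le:
  assumes Lf: "Lf = 0"
  shows "(\<integral>\<^sup>+(k, \<omega>). ennreal (obj (xag k \<omega>) - obj xs) \<partial>(index_measure \<Otimes>\<^sub>M \<Xi>))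
    \<le> ennreal (1 / total_weight * (\<Sum>k=1..N. \<beta> k * gap k *
        ((norm (x0 - xs))\<^sup>2 / (2 * lam 1) + \<sigma>\<^sup>2 * (\<Sum>j=1..k. noise_coeff j / real (m j)))))"
proof -
  let ?W = total_weight
  define B where "B k = (norm (x0 - xs))\<^sup>2 / (2 * lam 1)
      + \<sigma>\<^sup>2 * (\<Sum>j=1..k. noise_coeff j / real (m j))" for k
  have B: "0 \<le> B k" for k
    unfolding B_def using lam_pos[of 1] noise_coeff_nonneg
    by (intro add_nonneg_nonneg mult_nonneg_nonneg sum_nonneg divide_nonneg_nonneg) auto
  have w: "0 \<le> weight k / ?W" if "k \<in> {1..N}" for k
    using weight_pos[of k] total_weight_pos that by simp
  have each: "(\<integral>\<^sup>+\<omega>. ennreal (obj (xag k \<omega>) - obj xs) \<partial>\<Xi>) \<le> ennreal (\<Gamma> k * B k)"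
    if k: "k \<in> {1..N}" for k
  proof -
    define s where "s = (\<lambda>\<omega>. \<Sum>j=1..k. noise_coeff j * (norm (batch_err j \<omega>))\<^sup>2
        - \<alpha> j / \<Gamma> j * inner (batch_err j \<omega>) (xit (j - 1) \<omega> - xs))"
    have s: "integrable \<Xi> s" "(\<integral>\<omega>. s \<omega> \<partial>\<Xi>) \<le> \<sigma>\<^sup>2 * (\<Sum>j=1..k. noise_coeff j / real (m j))"
      unfolding s_def using noise_coeff_nonneg k by (intro noise_sum; simp)+
    have "(\<integral>\<^sup>+\<omega>. ennreal (obj (xag k \<omega>) - obj xs) \<partial>\<Xi>)
        \<le> ennreal (\<integral>\<omega>. \<Gamma> k * ((norm (x0 - xs))\<^sup>2 / (2 * lam 1) + s \<omega>) \<partial>\<Xi>)"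
    proof (rule nn_integral_le_integral)
      show "integrable \<Xi> (\<lambda>\<omega>. \<Gamma> k * ((norm (x0 - xs))\<^sup>2 / (2 * lam 1) + s \<omega>))"
        using s(1) by simp
      show "0 \<le> obj (xag k \<omega>) - obj xs" for \<omega>
        using xs_opt prox_map_in_dom k by (simp add: it_xag)
      show "obj (xag k \<omega>) - obj xs \<le> \<Gamma> k * ((norm (x0 - xs))\<^sup>2 / (2 * lam 1) + s \<omega>)" for \<omega>
        using obj_gap_le[OF run _ Lf, of k \<omega>] k by (simp add: s_def batch_err_def)
    qed
    also have "(\<integral>\<omega>. \<Gamma> k * ((norm (x0 - xs))\<^sup>2 / (2 * lam 1) + s \<omega>) \<partial>\<Xi>)
        = \<Gamma> k * ((norm (x0 - xs))\<^sup>2 / (2 * lam 1) + (\<integral>\<omega>. s \<omega> \<partial>\<Xi>))"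
      using s(1) by (simp add: \<Xi>.prob_space)
    also have "ennreal \<dots> \<le> ennreal (\<Gamma> k * B k)"
      unfolding B_def using s(2) less_imp_le[OF Gamma_pos[of k]]
      by (intro ennreal_leI mult_left_mono) auto
    finally show ?thesis .
  qed
  have "(\<integral>\<^sup>+(k, \<omega>). ennreal (obj (xag k \<omega>) - obj xs) \<partial>(index_measure \<Otimes>\<^sub>M \<Xi>))
      = (\<Sum>k=1..N. ennreal (weight k / ?W) * (\<integral>\<^sup>+\<omega>. ennreal (obj (xag k \<omega>) - obj xs) \<partial>\<Xi>))"
    using obj_xag_measurable by (intro nn_integral_random_index) auto
  also have "\<dots> \<le> (\<Sum>k=1..N. ennreal (weight k / ?W) * ennreal (\<Gamma> k * B k))"
    using each by (intro sum_mono mult_left_mono) auto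
  also have "\<dots> = (\<Sum>k=1..N. ennreal (weight k / ?W * (\<Gamma> k * B k)))"
    using w B less_imp_le[OF Gamma_pos] by (intro sum.cong refl ennreal_mult[symmetric]) auto
  also have "\<dots> = ennreal (\<Sum>k=1..N. weight k / ?W * (\<Gamma> k * B k))"
    using w B less_imp_le[OF Gamma_pos] by (intro sum_ennreal mult_nonneg_nonneg) auto
  \<comment> \<open>The factor \<open>\<Gamma> k\<close> from the bound at index \<open>k\<close>
    cancels the one in the denominator of \<open>weight k\<close>.\<close>
  also have "(\<Sum>k=1..N. weight k / ?W * (\<Gamma> k * B k)) = 1 / ?W * (\<Sum>k=1..N. \<beta> k * gap k * B k)"
  proof -
    have "weight k / ?W * (\<Gamma> k * B k) = 1 / ?W * (\<beta> k * gap k * B k)" for k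
      using Gamma_pos[of k] by (simp add: weight_def)
    then show ?thesis by (simp only: sum_distrib_left)
  qed
  finally show ?thesis unfolding B_def .
qed

end

text \<open>Independence of the index and the oracle is encoded by a product measure. Nonnegative
  integrals make the finite bounds include integrability; optimality of \<open>xs\<close> ensures
  that \<open>e2ennreal\<close> truncates nothing.\<close>

theorem theorem4:
  fixes f h :: "'a::euclidean_space \<Rightarrow> real"
    and gf gh :: "'a \<Rightarrow> 'a"
    and Xc :: "'a \<Rightarrow> ereal"
    and Lf Lh M \<sigma> :: real
    and G :: "'a \<Rightarrow> 'b \<Rightarrow> 'a"
    and S :: "'b measure"
    and D :: "nat \<Rightarrow> nat \<Rightarrow> 'b measure"
    and x0 xs :: 'a
    and \<alpha> \<beta> lam :: "nat \<Rightarrow> real"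
    and m :: "nat \<Rightarrow> nat"
    and N :: nat
    and L\<Psi> :: real
    and xit xag xmd Gbar :: "nat \<Rightarrow> (nat \<times> nat \<Rightarrow> 'b) \<Rightarrow> 'a"
  defines "\<Phi> \<equiv> (\<lambda>x. ereal (f x + h x) + Xc x)"
    and "g\<Psi> \<equiv> (\<lambda>x. gf x + gh x)"
    and "w \<equiv> (\<lambda>k. \<beta> k * (1 - L\<Psi> * \<beta> k) / Gam \<alpha> k)"
    and "\<Xi> \<equiv> (\<Pi>\<^sub>M c\<in>Sigma {1..N} (\<lambda>k. {1..m k}). D (fst c) (snd c))"
    and "PR \<equiv> point_measure {1..N}
           (\<lambda>k. ennreal (\<beta> k * (1 - L\<Psi> * \<beta> k) / Gam \<alpha> k
                 / (\<Sum>j=1..N. \<beta> j * (1 - L\<Psi> * \<beta> j) / Gam \<alpha> j)))"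
  assumes L\<Psi>_def: "L\<Psi> = Lf + Lh"
    and f_deriv: "\<And>x. (f has_derivative (\<lambda>v. inner (gf x) v)) (at x)"
    and f_lip: "\<And>x y. norm (gf x - gf y) \<le> Lf * norm (x - y)"
    and Lf_nonneg: "0 \<le> Lf"
    and h_convex: "convex_on UNIV h"
    and h_deriv: "\<And>x. (h has_derivative (\<lambda>v. inner (gh x) v)) (at x)"
    and h_lip: "\<And>x y. norm (gh x - gh y) \<le> Lh * norm (x - y)"
    and Lh_nonneg: "0 \<le> Lh"
    and Xc_proper: "proper_function Xc"
    and Xc_closed: "closed_function Xc"
    and Xc_convex: "convex_function Xc"
    and Xc_bdd: "bounded (effective_domain Xc)"
    and M_bound: "\<And>x y c. c > 0 \<Longrightarrow> norm (prox_map Xc x y c) \<le> M"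
    (* stochastic oracle: the i-th call at iteration k uses an independent sample \<xi>_{k,i} ~ D k i *)
    and D_prob: "\<And>k i. prob_space (D k i)"
    and D_sets: "\<And>k i. sets (D k i) = sets S"
    and G_meas: "(\<lambda>(x, \<xi>). G x \<xi>) \<in> borel_measurable (borel \<Otimes>\<^sub>M S)"
    and G_integrable: "\<And>k i x. integrable (D k i) (G x)"
    and G_unbiased: "\<And>k i x. (\<integral>\<xi>. G x \<xi> \<partial>D k i) = g\<Psi> x"
    and G_variance: "\<And>k i x. (\<integral>\<^sup>+\<xi>. ennreal ((norm (G x \<xi> - g\<Psi> x))\<^sup>2) \<partial>D k i)
                               \<le> ennreal (\<sigma>\<^sup>2)"
    (* parameters *)
    and \<alpha>1: "\<alpha> 1 = 1"
    and \<alpha>_range: "\<And>k. k \<ge> 2 \<Longrightarrow> 0 < \<alpha> k \<and> \<alpha> k < 1"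
    and \<beta>_pos: "\<And>k. k \<ge> 1 \<Longrightarrow> \<beta> k > 0"
    and lam_pos: "\<And>k. k \<ge> 1 \<Longrightarrow> lam k > 0"
    and m_pos: "\<And>k. k \<ge> 1 \<Longrightarrow> m k \<ge> 1"
    and N_pos: "N \<ge> 1"
    and step1: "\<And>k. k \<ge> 1 \<Longrightarrow> \<alpha> k * lam k \<le> \<beta> k"
    and step2: "\<And>k. k \<ge> 1 \<Longrightarrow> L\<Psi> * \<beta> k < 1"
    and step_mono: "\<And>k. k \<ge> 1 \<Longrightarrow>
        \<alpha> (Suc k) / (lam (Suc k) * Gam \<alpha> (Suc k)) \<le> \<alpha> k / (lam k * Gam \<alpha> k)"
    (* optimal solution *)
    and xs_opt: "\<And>x. \<Phi> xs \<le> \<Phi> x"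
    (* the mini-batch RSAG iterates, as functions of the samples \<omega>(k,i) = \<xi>_{k,i} *)
    and it_x0: "\<And>\<omega>. xit 0 \<omega> = x0"
    and it_xag0: "\<And>\<omega>. xag 0 \<omega> = x0"
    and it_md: "\<And>k \<omega>. k \<ge> 1 \<Longrightarrow>
        xmd k \<omega> = (1 - \<alpha> k) *\<^sub>R xag (k - 1) \<omega> + \<alpha> k *\<^sub>R xit (k - 1) \<omega>"
    and it_G: "\<And>k \<omega>. k \<ge> 1 \<Longrightarrow>
        Gbar k \<omega> = (1 / real (m k)) *\<^sub>R (\<Sum>i=1..m k. G (xmd k \<omega>) (\<omega> (k, i)))"
    and it_x: "\<And>k \<omega>. k \<ge> 1 \<Longrightarrow> xit k \<omega> = prox_map Xc (xit (k - 1) \<omega>) (Gbar k \<omega>) (lam k)"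
    and it_xag: "\<And>k \<omega>. k \<ge> 1 \<Longrightarrow> xag k \<omega> = prox_map Xc (xmd k \<omega>) (Gbar k \<omega>) (\<beta> k)"
  shows "(\<integral>\<^sup>+(k, \<omega>). ennreal ((norm (grad_map Xc (xmd k \<omega>) (g\<Psi> (xmd k \<omega>)) (\<beta> k)))\<^sup>2)
             \<partial>(PR \<Otimes>\<^sub>M \<Xi>))
         \<le> ennreal (8 / (\<Sum>k=1..N. w k) *
              ((norm (x0 - xs))\<^sup>2 / (2 * lam 1)
               + Lf / Gam \<alpha> N * ((norm xs)\<^sup>2 + 2 * M\<^sup>2)
               + \<sigma>\<^sup>2 * (\<Sum>k=1..N. \<beta> k * (4 + (1 - L\<Psi> * \<beta> k)\<^sup>2)
                         / (4 * Gam \<alpha> k * (1 - L\<Psi> * \<beta> k) * real (m k)))))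
       \<and> (Lf = 0 \<longrightarrow>
          (\<integral>\<^sup>+(k, \<omega>). e2ennreal (\<Phi> (xag k \<omega>) - \<Phi> xs) \<partial>(PR \<Otimes>\<^sub>M \<Xi>))
          \<le> ennreal (1 / (\<Sum>k=1..N. w k) *
              (\<Sum>k=1..N. \<beta> k * (1 - L\<Psi> * \<beta> k) *
                 ((norm (x0 - xs))\<^sup>2 / (2 * lam 1)
                  + \<sigma>\<^sup>2 * (\<Sum>j=1..k. \<beta> j * (4 + (1 - L\<Psi> * \<beta> j)\<^sup>2)
                            / (4 * Gam \<alpha> j * (1 - L\<Psi> * \<beta> j) * real (m j)))))))"
proof -
  interpret composite Xc f h gf gh Lf Lh
    by unfold_locales (fact assms)+
  have \<Phi>_obj: "\<Phi> x = ereal (obj x)" if "x \<in> effective_domain Xc" for x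
    using that by (simp add: \<Phi>_def obj_def smooth_def dom_eq_val)
  obtain v where v: "v \<in> effective_domain Xc" using dom_nonempty by blast
  \<comment> \<open>The objective is finite somewhere, hence also at its minimizer.\<close>
  have xs_dom: "xs \<in> effective_domain Xc"
  proof (rule ccontr)
    assume "xs \<notin> effective_domain Xc"
    then show False
      using xs_opt[of v] \<Phi>_obj[OF v] by (simp add: \<Phi>_def not_dom)
  qed
  have xs_min: "obj xs \<le> obj x" if "x \<in> effective_domain Xc" for x
    using xs_opt[of x] \<Phi>_obj[OF xs_dom] \<Phi>_obj[OF that] by simp
  have g\<Psi>_grad: "g\<Psi> = grad"
    by (simp add: g\<Psi>_def grad_def[abs_def])
  interpret rsag_parameters Xc f h gf gh Lf Lh M xs \<alpha> \<beta> lam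
    by unfold_locales (fact M_bound \<alpha>1 \<alpha>_range \<beta>_pos lam_pos step1 step2[unfolded L\<Psi>_def]
      step_mono xs_dom xs_min)+
  interpret rsag Xc f h gf gh Lf Lh M xs \<alpha> \<beta> lam \<sigma> G S D x0 m N xit xag xmd Gbar
    by (intro rsag.intro rsag_axioms.intro rsag_parameters_axioms)
      (fact D_prob D_sets G_meas G_integrable G_unbiased[unfolded g\<Psi>_grad]
      G_variance[unfolded g\<Psi>_grad] m_pos N_pos it_x0 it_xag0 it_md it_G it_x it_xag)+
  have w: "w k = weight k" for k
    by (simp add: w_def weight_def gap_def L\<Psi>_def)
  have W: "(\<Sum>k=1..N. w k) = total_weight"
    by (simp add: w total_weight_def)
  have \<Xi>_eq: "\<Xi> = Pi\<^sub>M calls (\<lambda>c. D (fst c) (snd c))"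
    by (simp add: \<Xi>_def calls_def)
  have PR_eq: "PR = index_measure"
    unfolding PR_def total_weight_def weight_def gap_def L\<Psi>_def ..
  have noise: "\<beta> k * (4 + (1 - L\<Psi> * \<beta> k)\<^sup>2) / (4 * Gam \<alpha> k * (1 - L\<Psi> * \<beta> k) * real (m k))
      = noise_coeff k / real (m k)" for k
    by (simp add: noise_coeff_def gap_def L\<Psi>_def)
  have gap: "1 - L\<Psi> * \<beta> k = gap k" for k
    by (simp add: gap_def L\<Psi>_def)
  \<comment> \<open>On the support of the index \<open>k \<ge> 1\<close>, so \<open>xag k\<close> is
    a prox value and its objective is finite. At \<open>k = 0\<close> this could fail, as
    \<open>x0\<close> may lie outside the domain.\<close>
  have \<Phi>_gap: "(\<integral>\<^sup>+(k, \<omega>). e2ennreal (\<Phi> (xag k \<omega>) - \<Phi> xs) \<partial>(PR \<Otimes>\<^sub>M \<Xi>))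
      = (\<integral>\<^sup>+(k, \<omega>). ennreal (obj (xag k \<omega>) - obj xs) \<partial>(PR \<Otimes>\<^sub>M \<Xi>))"
  proof (rule nn_integral_cong)
    fix z assume "z \<in> space (PR \<Otimes>\<^sub>M \<Xi>)"
    then obtain k \<omega> where z: "z = (k, \<omega>)" and k: "k \<in> {1..N}"
      by (cases z) (auto simp: space_pair_measure PR_def space_point_measure)
    have "xag k \<omega> \<in> effective_domain Xc"
      using k prox_map_in_dom by (simp add: it_xag)
    then show "(case z of (k, \<omega>) \<Rightarrow> e2ennreal (\<Phi> (xag k \<omega>) - \<Phi> xs))
        = (case z of (k, \<omega>) \<Rightarrow> ennreal (obj (xag k \<omega>) - obj xs))"
      by (simp add: z \<Phi>_obj xs_dom ennreal_def)
  qed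
  show ?thesis
    using expected_grad_map_le expected_obj_gap_le
    unfolding W noise \<Phi>_gap unfolding PR_eq \<Xi>_eq g\<Psi>_grad gap by blast
qed

end
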